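(* There exist absolute constants implicit in the $O(\cdot)$ below such that the following holds. Let $X \in \mathbb{R}^{d \times n}$ be a matrix with columns $x_1,\dots,x_n$, let $m,k$ be positive integers, let $\Lambda>0$ and $\gamma^*\ge 0$, and suppose there exist (unknown) matrices $A^* \in \mathbb{R}^{d\times m}$ and $Y^* \in \mathbb{R}^{m \times n}$ such that (a) the columns of $A^*$ are all unit vectors; (b) each column $Y^*_i$ of $Y^*$ is $k$-sparse and satisfies $\|Y_i^*\|^2 \le \Lambda \|x_i\|^2$; (c) $\|X - A^* Y^*\|_F^2 \le \gamma^* \|X\|_F^2$. Let $\varepsilon > 0$. Then there is an efficient algorithm that, given $X, m, k, \Lambda, \varepsilon$, outputs matrices $A', Y'$ such that $\|X - A'Y'\|_F^2 \le (\gamma^* + \varepsilon) \|X\|_F^2$, the number of columns of $A'$ is at most $O\left(\frac{m k^2 \Lambda^3}{\varepsilon^5}\right)$, and every column of $Y'$ has at most $O\left(\frac{k^2\Lambda^2}{\varepsilon^4}\right)$ non-zero entries.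
   Context: $\|\cdot\|$ is the Euclidean norm and $\|\cdot\|_F$ the Frobenius norm. A vector is $k$-sparse if it has at most $k$ non-zero entries. "Efficient" means polynomial running time (in the input size and in the parameters $m, k, \Lambda, 1/\varepsilon$).
   Formalization: The number of columns of A' is bounded by C·mk²Λ³/ε⁵ rounded up to an integer; without rounding the claim fails, e.g. d=n=m=k=1, X=(1), A*=(1), Y*=(δ), Λ=δ², ε=δ, γ*=(1−δ)² with δ small, where one column is needed. *)

theory Defs
  imports Complex_Main "Jordan_Normal_Form.Matrix"
begin

section \<open>Vectors and matrices\<close>

definition enorm :: "real vec \<Rightarrow> real" where
  "enorm v = sqrt (\<Sum>j<dim_vec v. (v $ j)\<^sup>2)"

definition fnorm :: "real mat \<Rightarrow> real" where
  "fnorm M = sqrt (\<Sum>i<dim_row M. \<Sum>j<dim_col M. (M $$ (i, j))\<^sup>2)"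

definition nnz :: "real vec \<Rightarrow> nat" where
  "nnz v = card {j. j < dim_vec v \<and> v $ j \<noteq> 0}"

definition sparse :: "nat \<Rightarrow> real vec \<Rightarrow> bool" where
  "sparse k v \<longleftrightarrow> nnz v \<le> k"


section \<open>Algorithms: unit-cost real RAM programs\<close>

text \<open>
  An algorithm is a finite program over natural-number registers and two-dimensional arrays
  of reals, both addressed by name. Available are exact arithmetic and comparison on reals,
  addition and (truncated) subtraction on naturals, the cast from naturals to reals, and
  indexed array access. There is deliberately no rounding from reals to naturals, no
  multiplication on naturals and no irrational constant, so that neither number-theoretic
  tricks at unit cost nor information hidden in a constant is possible.
  A scalar real is an array that is used only at position \<open>(0, 0)\<close>; array names are fixed in
  the program text, but the positions are computed.
\<close>

type_synonym name = string

record store =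
  reg :: "name \<Rightarrow> nat"
  arr :: "name \<Rightarrow> nat \<Rightarrow> nat \<Rightarrow> real"

datatype iexp =
    IConst nat
  | IReg name
  | IAdd iexp iexp
  | ISub iexp iexp

datatype rexp =
    RCast iexp
  | RCell name iexp iexp
  | RAdd rexp rexp
  | RSub rexp rexp
  | RMul rexp rexp
  | RDiv rexp rexp

datatype bexp =
    ILess iexp iexp
  | RLess rexp rexp
  | BNot bexp
  | BAnd bexp bexp

datatype com =
    Skip
  | SetReg name iexp
  | SetCell name iexp iexp rexp
  | Seq com com
  | Cond bexp com com
  | Loop bexp com

fun ival :: "iexp \<Rightarrow> store \<Rightarrow> nat" where
  "ival (IConst c) s = c"
| "ival (IReg x) s = reg s x"
| "ival (IAdd a b) s = ival a s + ival b s"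
| "ival (ISub a b) s = ival a s - ival b s"

fun rval :: "rexp \<Rightarrow> store \<Rightarrow> real" where
  "rval (RCast a) s = real (ival a s)"
| "rval (RCell x i j) s = arr s x (ival i s) (ival j s)"
| "rval (RAdd a b) s = rval a s + rval b s"
| "rval (RSub a b) s = rval a s - rval b s"
| "rval (RMul a b) s = rval a s * rval b s"
| "rval (RDiv a b) s = rval a s / rval b s"

fun bval :: "bexp \<Rightarrow> store \<Rightarrow> bool" where
  "bval (ILess a b) s \<longleftrightarrow> ival a s < ival b s"
| "bval (RLess a b) s \<longleftrightarrow> rval a s < rval b s"
| "bval (BNot b) s \<longleftrightarrow> \<not> bval b s"
| "bval (BAnd a b) s \<longleftrightarrow> bval a s \<and> bval b s"

definition set_reg :: "name \<Rightarrow> nat \<Rightarrow> store \<Rightarrow> store" where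
  "set_reg x c s = s\<lparr>reg := (reg s)(x := c)\<rparr>"

definition set_cell :: "name \<Rightarrow> nat \<Rightarrow> nat \<Rightarrow> real \<Rightarrow> store \<Rightarrow> store" where
  "set_cell x i j c s = s\<lparr>arr := (arr s)(x := (arr s x)(i := (arr s x i)(j := c)))\<rparr>"

text \<open>
  \<open>exec P s t s'\<close>: started in \<open>s\<close>, the program \<open>P\<close> halts in \<open>s'\<close> after \<open>t\<close> steps. Every
  assignment and every evaluated test is one step; the expressions occurring in a program have
  bounded size, so counting single operations instead changes \<open>t\<close> by at most a factor depending
  on \<open>P\<close> only.
\<close>

inductive exec :: "com \<Rightarrow> store \<Rightarrow> nat \<Rightarrow> store \<Rightarrow> bool" where
  Skip: "exec Skip s 1 s"
| SetReg: "exec (SetReg x a) s 1 (set_reg x (ival a s) s)"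
| SetCell: "exec (SetCell x i j a) s 1 (set_cell x (ival i s) (ival j s) (rval a s) s)"
| Seq: "exec P s t s' \<Longrightarrow> exec Q s' u s'' \<Longrightarrow> exec (Seq P Q) s (t + u) s''"
| CondTrue: "bval b s \<Longrightarrow> exec P s t s' \<Longrightarrow> exec (Cond b P Q) s (t + 1) s'"
| CondFalse: "\<not> bval b s \<Longrightarrow> exec Q s t s' \<Longrightarrow> exec (Cond b P Q) s (t + 1) s'"
| LoopFalse: "\<not> bval b s \<Longrightarrow> exec (Loop b P) s 1 s"
| LoopTrue: "bval b s \<Longrightarrow> exec P s t s' \<Longrightarrow> exec (Loop b P) s' u s'' \<Longrightarrow>
    exec (Loop b P) s (t + u + 1) s''"

inductive_cases exec_SkipE: "exec Skip s t s'"
inductive_cases exec_SetRegE: "exec (SetReg x a) s t s'"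
inductive_cases exec_SetCellE: "exec (SetCell x i j a) s t s'"
inductive_cases exec_SeqE: "exec (Seq P Q) s t s'"
inductive_cases exec_CondE: "exec (Cond b P Q) s t s'"
inductive_cases exec_LoopE: "exec (Loop b P) s t s'"

lemma exec_deterministic:
  assumes "exec P s t s'" and "exec P s u s''"
  shows "t = u \<and> s' = s''"
  using assms
proof (induction arbitrary: u s'' rule: exec.induct)
  case Skip
  then show ?case by (auto elim: exec_SkipE)
next
  case SetReg
  then show ?case by (auto elim: exec_SetRegE)
next
  case SetCell
  then show ?case by (auto elim: exec_SetCellE)
next
  case (Seq P s t s' Q v r)
  from Seq.prems obtain t1 t2 z where "exec P s t1 z" "exec Q z t2 s''" "u = t1 + t2"
    by (auto elim: exec_SeqE)
  with Seq.IH(1)[of t1 z] Seq.IH(2)[of t2 s''] show ?case by simp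
next
  case (CondTrue b s P t s' Q)
  from CondTrue.prems CondTrue.hyps obtain t1 where "exec P s t1 s''" "u = t1 + 1"
    by (auto elim: exec_CondE)
  with CondTrue.IH[of t1 s''] show ?case by simp
next
  case (CondFalse b s Q t s' P)
  from CondFalse.prems CondFalse.hyps obtain t1 where "exec Q s t1 s''" "u = t1 + 1"
    by (auto elim: exec_CondE)
  with CondFalse.IH[of t1 s''] show ?case by simp
next
  case (LoopFalse b s P)
  from LoopFalse.prems LoopFalse.hyps show ?case by (auto elim: exec_LoopE)
next
  case (LoopTrue b s P t s' v r)
  from LoopTrue.prems LoopTrue.hyps obtain t1 t2 z
    where "exec P s t1 z" "exec (Loop b P) z t2 s''" "u = t1 + t2 + 1"
    by (auto elim: exec_LoopE)
  with LoopTrue.IH(1)[of t1 z] LoopTrue.IH(2)[of t2 s''] show ?case by simp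
qed


section \<open>Input and output conventions\<close>

text \<open>The dimensions are those of the input matrix; everything else in the store is zero.\<close>

definition input_store :: "real mat \<Rightarrow> nat \<Rightarrow> nat \<Rightarrow> real \<Rightarrow> real \<Rightarrow> store" where
  "input_store X m k \<Lambda> \<epsilon> =
    \<lparr>reg = (\<lambda>_. 0)(''d'' := dim_row X, ''n'' := dim_col X, ''m'' := m, ''k'' := k),
     arr = (\<lambda>_ _ _. 0)
       (''X'' := (\<lambda>i j. if i < dim_row X \<and> j < dim_col X then X $$ (i, j) else 0),
        ''Lambda'' := (\<lambda>i j. if i = 0 \<and> j = 0 then \<Lambda> else 0),
        ''epsilon'' := (\<lambda>i j. if i = 0 \<and> j = 0 then \<epsilon> else 0))\<rparr>"

definition array_mat :: "store \<Rightarrow> name \<Rightarrow> nat \<Rightarrow> nat \<Rightarrow> real mat" where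
  "array_mat s x nr nc = mat nr nc (\<lambda>(i, j). arr s x i j)"

text \<open>
  For a \<open>d \<times> n\<close> input the output is a \<open>d \<times> m'\<close> matrix and an \<open>m' \<times> n\<close> matrix, where the program
  leaves its choice of \<open>m'\<close> in the register \<open>m_out\<close>.
\<close>

definition outputs :: "com \<Rightarrow> real mat \<Rightarrow> nat \<Rightarrow> nat \<Rightarrow> real \<Rightarrow> real \<Rightarrow> nat \<Rightarrow> real mat \<Rightarrow> real mat \<Rightarrow> bool"
  where
  "outputs P X m k \<Lambda> \<epsilon> t A Y \<longleftrightarrow>
    (\<exists>s. exec P (input_store X m k \<Lambda> \<epsilon>) t s \<and>
         A = array_mat s ''A'' (dim_row X) (reg s ''m_out'') \<and>
         Y = array_mat s ''Y'' (reg s ''m_out'') (dim_col X))"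

end

(*
  The program is a greedy pursuit. It maintains an approximation P = A Y of X whose columns p_i are
  orthogonal to the residuals r_i = x_i - p_i. One round picks the residual z = r_l that promises the
  largest total decrease of the squared error, appends it to A, subtracts its multiple from those
  residuals r_i for which this decreases |r_i|^2 by more than c |x_i|^2, where
  c = eps^4 / (1024 k^2 Lambda^2), and rescales the changed columns to restore orthogonality.
  A column can change at most 1 / c times, which bounds the nonzero entries of Y.

  As long as the error exceeds (gamma + eps) |X|^2, sparsity and the bound on Y* yield one unknown
  atom a that correlates well with many residuals: the sum S of those <r_i, a>^2 that exceed
  theta^2 |x_i|^2 is at least eps^2 |X|^2 / (16 Lambda m), where theta^2 = eps^2 / (16 k Lambda).
  Since <sum_i <r_i, a> r_i, a> = S, the vector sum_i <r_i, a> r_i has norm at least S, and expanding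
  its square shows that some residual r_l is itself correlated with many others. So the atom need
  not be known, and one round removes at least eps^4 |X|^2 / (1024 Lambda^2 m k). Finally
  |A* y|^2 <= k Lambda |x|^2 implies gamma + eps >= 1 - k Lambda / eps, hence only
  (k Lambda / eps) |X|^2 has to be removed, which takes 1024 m k^2 Lambda^3 / eps^5 rounds.
*)
theory Submission
  imports Defs "HOL-Analysis.L2_Norm"
begin

section \<open>Sums of products\<close>

text \<open>Vectors are functions restricted to an index set. Columns of store arrays can thus be
  used as they are, and one Cauchy-Schwarz inequality serves sums over rows, over columns and over
  atoms.\<close>

definition dot :: "'a set \<Rightarrow> ('a \<Rightarrow> real) \<Rightarrow> ('a \<Rightarrow> real) \<Rightarrow> real" where
  "dot D u v = (\<Sum>a\<in>D. u a * v a)"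

lemma dot_commute: "dot D u v = dot D v u"
  by (simp add: dot_def mult.commute)

lemma dot_add_left: "dot D (\<lambda>a. u a + v a) w = dot D u w + dot D v w"
  by (simp add: dot_def algebra_simps sum.distrib)

lemma dot_diff_left: "dot D (\<lambda>a. u a - v a) w = dot D u w - dot D v w"
  by (simp add: dot_def algebra_simps sum_subtractf)

lemma dot_scale_left: "dot D (\<lambda>a. c * u a) w = c * dot D u w"
  by (simp add: dot_def algebra_simps sum_distrib_left)

lemma dot_add_right: "dot D w (\<lambda>a. u a + v a) = dot D w u + dot D w v"
  by (simp add: dot_def algebra_simps sum.distrib)

lemma dot_diff_right: "dot D w (\<lambda>a. u a - v a) = dot D w u - dot D w v"
  by (simp add: dot_def algebra_simps sum_subtractf)

lemma dot_scale_right: "dot D w (\<lambda>a. c * u a) = c * dot D w u"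
  by (simp add: dot_def algebra_simps sum_distrib_left)

lemma dot_sum_left: "dot D (\<lambda>a. \<Sum>i\<in>I. c i * u i a) w = (\<Sum>i\<in>I. c i * dot D (u i) w)"
proof -
  have "dot D (\<lambda>a. \<Sum>i\<in>I. c i * u i a) w = (\<Sum>a\<in>D. \<Sum>i\<in>I. c i * (u i a * w a))"
    by (simp add: dot_def sum_distrib_right mult.assoc)
  also have "\<dots> = (\<Sum>i\<in>I. \<Sum>a\<in>D. c i * (u i a * w a))" by (rule sum.swap)
  finally show ?thesis by (simp add: dot_def sum_distrib_left)
qed

lemma dot_sum_right: "dot D w (\<lambda>a. \<Sum>i\<in>I. c i * u i a) = (\<Sum>i\<in>I. c i * dot D w (u i))"
  using dot_sum_left[of D c u I w] by (simp add: dot_commute)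

lemmas dot_simps = dot_add_left dot_diff_left dot_scale_left dot_add_right dot_diff_right
  dot_scale_right

lemma dot_self_nonneg [simp]: "0 \<le> dot D u u"
  by (simp add: dot_def sum_nonneg)

lemma Cauchy_Schwarz_dot: "(dot D u v)\<^sup>2 \<le> dot D u u * dot D v v"
proof -
  have "\<bar>dot D u v\<bar> \<le> (\<Sum>a\<in>D. \<bar>u a\<bar> * \<bar>v a\<bar>)"
    unfolding dot_def by (rule order_trans[OF sum_abs]) (simp add: abs_mult)
  also have "\<dots> \<le> L2_set u D * L2_set v D" by (rule L2_set_mult_ineq)
  finally have "\<bar>dot D u v\<bar>\<^sup>2 \<le> (L2_set u D * L2_set v D)\<^sup>2" by (rule power_mono) simp
  then show ?thesis
    by (simp add: power_mult_distrib L2_set_def sum_nonneg) (simp add: dot_def power2_eq_square)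
qed

text \<open>Makes quotients by \<open>dot D u u\<close> safe: the numerator vanishes together with
  the denominator, so multiplying back is correct although \<open>x / 0 = 0\<close>.\<close>

lemma dot_self_eq_0: "dot D u u = 0 \<Longrightarrow> dot D u v = 0"
  using Cauchy_Schwarz_dot[of D u v] by simp

lemma young:
  fixes a b t :: real
  assumes t: "0 < t"
  shows "a * b \<le> t * a\<^sup>2 / 2 + b\<^sup>2 / (2 * t)"
proof -
  have "0 \<le> (t * a - b)\<^sup>2 / (2 * t)" using t by simp
  also have "\<dots> = t * a\<^sup>2 / 2 + b\<^sup>2 / (2 * t) - a * b"
    using t by (simp add: field_simps power2_eq_square)
  finally show ?thesis by simp
qed

text \<open>Cauchy-Schwarz against the constant 1 on the support of \<open>y\<close>.\<close>

lemma sparse_l1_l2: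
  fixes y :: "'j \<Rightarrow> real"
  assumes "finite J" "card {j\<in>J. y j \<noteq> 0} \<le> k"
  shows "(\<Sum>j\<in>J. \<bar>y j\<bar>)\<^sup>2 \<le> real k * (\<Sum>j\<in>J. (y j)\<^sup>2)"
proof -
  let ?K = "{j\<in>J. y j \<noteq> 0}"
  have "(\<Sum>j\<in>J. \<bar>y j\<bar>) = dot ?K (\<lambda>_. 1) (\<lambda>j. \<bar>y j\<bar>)"
    unfolding dot_def using assms(1) by (intro sum.mono_neutral_cong_right) auto
  then have "(\<Sum>j\<in>J. \<bar>y j\<bar>)\<^sup>2 \<le> real (card ?K) * (\<Sum>j\<in>?K. (y j)\<^sup>2)"
    using Cauchy_Schwarz_dot[of ?K "\<lambda>_. 1" "\<lambda>j. \<bar>y j\<bar>"] by (simp add: dot_def power2_eq_square)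
  also have "(\<Sum>j\<in>?K. (y j)\<^sup>2) = (\<Sum>j\<in>J. (y j)\<^sup>2)"
    using assms(1) by (intro sum.mono_neutral_cong_left) auto
  also have "real (card ?K) * \<dots> \<le> real k * \<dots>"
    using assms(2) by (intro mult_right_mono) (auto simp: sum_nonneg)
  finally show ?thesis .
qed

section \<open>Progress of one pursuit step\<close>

text \<open>A residual that loses its component along \<open>z\<close> has its squared norm reduced
  by \<open>(dot D z (r i))\<^sup>2 / dot D z z\<close>; only reductions above
  \<open>c * N i\<close> count. The test is multiplied through by \<open>dot D z z\<close>, so a
  vanishing \<open>z\<close> fails it for every \<open>i\<close>.\<close>

definition gain :: "'a set \<Rightarrow> 'i set \<Rightarrow> real \<Rightarrow> ('i \<Rightarrow> real) \<Rightarrow> ('i \<Rightarrow> 'a \<Rightarrow> real) \<Rightarrow> ('a \<Rightarrow> real) \<Rightarrow> real"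
  where
  "gain D I c N r z = (\<Sum>i\<in>I. if c * dot D z z * N i < (dot D z (r i))\<^sup>2
     then (dot D z (r i))\<^sup>2 / dot D z z else 0)"

lemma gain_nonneg: "0 \<le> gain D I c N r z"
  unfolding gain_def by (intro sum_nonneg) auto

text \<open>Expand \<open>|\<Sum>\<^sub>i w\<^sub>i r\<^sub>i|\<^sup>2\<close>, which is at least \<open>S\<^sup>2\<close>, into inner products of residuals.
  The pairs that fail the test in \<open>gain\<close> account for at most half of \<open>S\<^sup>2\<close>, because a nonzero
  weight \<open>w\<^sub>i\<close> dominates \<open>\<theta> sqrt N\<^sub>i\<close>; the others are bounded by Cauchy-Schwarz.\<close>

lemma gain_ge_of_weights:
  fixes r :: "'i \<Rightarrow> 'a \<Rightarrow> real"
  assumes \<theta>: "0 < \<theta>" and \<kappa>: "0 \<le> \<kappa>" "\<kappa> \<le> \<theta>\<^sup>2 / 2" and c: "c = \<kappa>\<^sup>2"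
    and rN: "\<And>i. i \<in> I \<Longrightarrow> dot D (r i) (r i) \<le> N i"
    and w: "\<And>i. i \<in> I \<Longrightarrow> w i = 0 \<or> \<theta>\<^sup>2 * N i \<le> (w i)\<^sup>2"
    and S: "S = (\<Sum>i\<in>I. (w i)\<^sup>2)"
    and V: "S\<^sup>2 \<le> (\<Sum>l\<in>I. \<Sum>i\<in>I. w l * w i * dot D (r l) (r i))"
    and g: "0 \<le> g" "\<And>l. l \<in> I \<Longrightarrow> gain D I c N r (r l) \<le> g"
  shows "\<theta>\<^sup>2 * S \<le> 4 * g"
proof -
  define G where "G l i = dot D (r l) (r i)" for l i
  define h where "h l i = (if c * G l l * N i < (G l i)\<^sup>2 then \<bar>G l i\<bar> else 0)" for l i
  have N0: "0 \<le> N i" if "i \<in> I" for i using rN[OF that] dot_self_nonneg order_trans by blast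
  have S0: "0 \<le> S" using S by (simp add: sum_nonneg)
  have wN: "\<bar>w i\<bar> * (\<theta> * sqrt (N i)) \<le> (w i)\<^sup>2" if "i \<in> I" for i
  proof (cases "w i = 0")
    case False
    then have "(\<theta> * sqrt (N i))\<^sup>2 \<le> \<bar>w i\<bar>\<^sup>2" using w[OF that] N0[OF that]
      by (simp add: power_mult_distrib)
    then have "\<theta> * sqrt (N i) \<le> \<bar>w i\<bar>" by (rule power2_le_imp_le) simp
    then have "\<bar>w i\<bar> * (\<theta> * sqrt (N i)) \<le> \<bar>w i\<bar> * \<bar>w i\<bar>" by (rule mult_left_mono) simp
    then show ?thesis by (simp add: power2_eq_square)
  qed simp
  have term_le: "w l * w i * G l i \<le> (w l)\<^sup>2 * (w i)\<^sup>2 / 2 + \<bar>w l\<bar> * (\<bar>w i\<bar> * h l i)"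
    if l: "l \<in> I" and i: "i \<in> I" for l i
  proof (cases "c * G l l * N i < (G l i)\<^sup>2")
    case True
    have "w l * w i * G l i \<le> \<bar>w l * w i * G l i\<bar>" by simp
    also have "\<dots> = \<bar>w l\<bar> * (\<bar>w i\<bar> * h l i)" using True by (simp add: h_def abs_mult)
    finally show ?thesis by (simp add: add_increasing)
  next
    case False
    then have "\<bar>G l i\<bar>\<^sup>2 \<le> \<kappa>\<^sup>2 * G l l * N i" using c by simp
    also have "\<dots> \<le> \<kappa>\<^sup>2 * N l * N i"
      using rN[OF l] N0[OF i] by (intro mult_right_mono mult_left_mono) (auto simp: G_def)
    also have "\<dots> = (\<kappa> * sqrt (N l) * sqrt (N i))\<^sup>2"
      using N0 l i by (simp add: power_mult_distrib)
    finally have G: "\<bar>G l i\<bar> \<le> \<kappa> * sqrt (N l) * sqrt (N i)"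
      by (rule power2_le_imp_le) (use \<kappa> N0 l i in auto)
    have "w l * w i * G l i \<le> \<bar>w l\<bar> * \<bar>w i\<bar> * \<bar>G l i\<bar>"
      by (metis abs_ge_self abs_mult)
    also have "\<dots> \<le> \<bar>w l\<bar> * \<bar>w i\<bar> * (\<kappa> * sqrt (N l) * sqrt (N i))"
      using G by (rule mult_left_mono) simp
    also have "\<dots> \<le> \<bar>w l\<bar> * \<bar>w i\<bar> * (\<theta>\<^sup>2 / 2 * sqrt (N l) * sqrt (N i))"
      using \<kappa>(2) N0 l i by (intro mult_left_mono mult_right_mono) auto
    also have "\<dots> = (\<bar>w l\<bar> * (\<theta> * sqrt (N l))) * (\<bar>w i\<bar> * (\<theta> * sqrt (N i))) / 2"
      by (simp add: power2_eq_square)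
    also have "\<dots> \<le> (w l)\<^sup>2 * (w i)\<^sup>2 / 2"
      using wN[OF l] wN[OF i] \<theta> N0 l i by (intro divide_right_mono mult_mono) auto
    finally show ?thesis using False by (simp add: h_def)
  qed
  have inner: "\<theta> * (\<bar>w l\<bar> * (\<Sum>i\<in>I. \<bar>w i\<bar> * h l i)) \<le> (w l)\<^sup>2 * sqrt (g * S)" if l: "l \<in> I" for l
  proof -
    \<comment> \<open>Also true for \<open>G l l = 0\<close>, where \<open>G l i\<close> vanishes as
      well.\<close>
    have h2: "(h l i)\<^sup>2 = G l l * (if c * G l l * N i < (G l i)\<^sup>2 then (G l i)\<^sup>2 / G l l else 0)" for i
      using dot_self_eq_0[of D "r l" "r i"] by (auto simp: h_def G_def)
    have "(\<Sum>i\<in>I. (h l i)\<^sup>2) = G l l * gain D I c N r (r l)"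
      unfolding gain_def G_def[symmetric] h2 by (simp add: sum_distrib_left)
    also have "\<dots> \<le> N l * g"
      using rN[OF l] g(2)[OF l] gain_nonneg N0[OF l] by (intro mult_mono) (auto simp: G_def)
    finally have hs: "(\<Sum>i\<in>I. (h l i)\<^sup>2) \<le> N l * g" .
    have "(\<Sum>i\<in>I. \<bar>w i\<bar> * h l i)\<^sup>2 \<le> S * (\<Sum>i\<in>I. (h l i)\<^sup>2)"
      using Cauchy_Schwarz_dot[of I "\<lambda>i. \<bar>w i\<bar>" "h l"] S by (simp add: dot_def power2_eq_square)
    also have "\<dots> \<le> S * (N l * g)" using hs S0 by (rule mult_left_mono)
    also have "\<dots> = (sqrt (g * S) * sqrt (N l))\<^sup>2"
      using g(1) S0 N0[OF l] by (simp add: power_mult_distrib)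
    finally have "(\<Sum>i\<in>I. \<bar>w i\<bar> * h l i) \<le> sqrt (g * S) * sqrt (N l)"
      by (rule power2_le_imp_le) (use g S0 N0[OF l] in auto)
    then have "\<bar>w l\<bar> * \<theta> * (\<Sum>i\<in>I. \<bar>w i\<bar> * h l i) \<le> \<bar>w l\<bar> * \<theta> * (sqrt (g * S) * sqrt (N l))"
      by (rule mult_left_mono) (use \<theta> in auto)
    also have "\<dots> = (\<bar>w l\<bar> * (\<theta> * sqrt (N l))) * sqrt (g * S)" by simp
    also have "\<dots> \<le> (w l)\<^sup>2 * sqrt (g * S)"
      using wN[OF l] g S0 by (intro mult_right_mono) auto
    finally show ?thesis by (simp add: mult.left_commute mult.assoc)
  qed
  have "S\<^sup>2 \<le> (\<Sum>l\<in>I. \<Sum>i\<in>I. (w l)\<^sup>2 * (w i)\<^sup>2 / 2 + \<bar>w l\<bar> * (\<bar>w i\<bar> * h l i))"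
    using V unfolding G_def[symmetric]
    by (rule order_trans) (intro sum_mono term_le)
  also have "\<dots> = (\<Sum>l\<in>I. \<Sum>i\<in>I. (w l)\<^sup>2 * (w i)\<^sup>2 / 2)
      + (\<Sum>l\<in>I. \<bar>w l\<bar> * (\<Sum>i\<in>I. \<bar>w i\<bar> * h l i))"
    by (simp add: sum.distrib sum_distrib_left)
  also have "(\<Sum>l\<in>I. \<Sum>i\<in>I. (w l)\<^sup>2 * (w i)\<^sup>2 / 2) = S\<^sup>2 / 2"
    unfolding S power2_eq_square[of "sum _ _"] sum_product sum_divide_distrib ..
  finally have "S\<^sup>2 / 2 \<le> (\<Sum>l\<in>I. \<bar>w l\<bar> * (\<Sum>i\<in>I. \<bar>w i\<bar> * h l i))" by simp
  then have "\<theta> * (S\<^sup>2 / 2) \<le> (\<Sum>l\<in>I. \<theta> * (\<bar>w l\<bar> * (\<Sum>i\<in>I. \<bar>w i\<bar> * h l i)))"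
    using \<theta> by (simp add: sum_distrib_left[symmetric])
  also have "\<dots> \<le> (\<Sum>l\<in>I. (w l)\<^sup>2 * sqrt (g * S))" by (intro sum_mono inner)
  also have "\<dots> = S * sqrt (g * S)" by (simp add: S sum_distrib_right)
  finally have *: "S * (\<theta> * S / 2) \<le> S * sqrt (g * S)" by (simp add: power2_eq_square mult_ac)
  show ?thesis
  proof (cases "S = 0")
    case False
    with S0 have S: "0 < S" by simp
    with * have "\<theta> * S / 2 \<le> sqrt (g * S)" by simp
    \<comment> \<open>Squaring and cancelling \<open>S\<close> turns the 1/2 into the factor 4 of
      the claim.\<close>
    then have "(\<theta> * S / 2)\<^sup>2 \<le> (sqrt (g * S))\<^sup>2" by (rule power_mono) (use \<theta> S in auto)
    then have "S * (\<theta>\<^sup>2 * S) \<le> S * (4 * g)"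
      using g S by (simp add: power2_eq_square mult_ac)
    with S show ?thesis by simp
  qed (use g in simp)
qed

text \<open>Pairing each residual with the unknown approximation of its column gives at least
  \<open>\<epsilon> * F / 2\<close> in total. Correlations below the threshold account for at most
  half of this, because sparsity bounds the sum of the absolute values of \<open>y\<close>. Young's
  inequality spends half of the rest on the size of \<open>y\<close>; what remains is bounded by
  squared large correlations, and averaging over the atoms selects one.\<close>

lemma exists_correlated_atom:
  fixes x r :: "'i \<Rightarrow> 'a \<Rightarrow> real" and a :: "'j \<Rightarrow> 'a \<Rightarrow> real" and y :: "'i \<Rightarrow> 'j \<Rightarrow> real"
    and \<Lambda> \<epsilon> \<gamma> :: real and k :: nat
  assumes J: "finite J" "J \<noteq> {}" and pos: "0 < \<Lambda>" "0 < \<epsilon>" "0 < k"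
    and N: "\<And>i. N i = dot D (x i) (x i)" and F: "F = (\<Sum>i\<in>I. N i)"
    and rx: "\<And>i. i \<in> I \<Longrightarrow> dot D (r i) (x i) = dot D (r i) (r i)"
    and sp: "\<And>i. i \<in> I \<Longrightarrow> card {j\<in>J. y i j \<noteq> 0} \<le> k"
    and yN: "\<And>i. i \<in> I \<Longrightarrow> (\<Sum>j\<in>J. (y i j)\<^sup>2) \<le> \<Lambda> * N i"
    and err: "(\<Sum>i\<in>I. dot D (\<lambda>b. x i b - (\<Sum>j\<in>J. y i j * a j b)) (\<lambda>b. x i b - (\<Sum>j\<in>J. y i j * a j b)))
      \<le> \<gamma> * F"
    and large: "(\<gamma> + \<epsilon>) * F \<le> (\<Sum>i\<in>I. dot D (r i) (r i))"
    and \<theta>: "0 \<le> \<theta>" "\<theta>\<^sup>2 * (16 * k * \<Lambda>) = \<epsilon>\<^sup>2"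
  obtains j where "j \<in> J"
    "\<epsilon>\<^sup>2 * F \<le> 16 * \<Lambda> * card J *
      (\<Sum>i\<in>I. if \<theta>\<^sup>2 * N i < (dot D (r i) (a j))\<^sup>2 then (dot D (r i) (a j))\<^sup>2 else 0)"
proof -
  define \<beta> where "\<beta> i j = dot D (r i) (a j)" for i j
  define b where "b i j = (if \<theta>\<^sup>2 * N i < (\<beta> i j)\<^sup>2 then \<beta> i j else 0)" for i j
  have N0: "0 \<le> N i" for i by (simp add: N)
  \<comment> \<open>Since <r, x> = |r|^2, this is 2 <r, e> \<le> |r|^2 + |e|^2 for the error e of
    the unknown approximation.\<close>
  have col: "dot D (r i) (r i) / 2 - dot D (\<lambda>b. x i b - (\<Sum>j\<in>J. y i j * a j b))
      (\<lambda>b. x i b - (\<Sum>j\<in>J. y i j * a j b)) / 2 \<le> (\<Sum>j\<in>J. y i j * \<beta> i j)" if i: "i \<in> I" for i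
  proof -
    let ?e = "\<lambda>b. x i b - (\<Sum>j\<in>J. y i j * a j b)"
    have "(\<Sum>j\<in>J. y i j * \<beta> i j) = dot D (r i) (\<lambda>b. \<Sum>j\<in>J. y i j * a j b)"
      by (simp add: \<beta>_def dot_sum_right)
    also have "\<dots> = dot D (r i) (r i) - dot D (r i) ?e"
      using rx[OF i] by (simp add: dot_diff_right)
    finally have "(\<Sum>j\<in>J. y i j * \<beta> i j) = dot D (r i) (r i) - dot D (r i) ?e" .
    moreover have "0 \<le> dot D (\<lambda>b. r i b - ?e b) (\<lambda>b. r i b - ?e b)" by (rule dot_self_nonneg)
    then have "2 * dot D (r i) ?e \<le> dot D (r i) (r i) + dot D ?e ?e"
      by (subst (asm) dot_diff_left, subst (asm) dot_diff_right, subst (asm) dot_diff_right)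
        (simp add: dot_commute[of D ?e "r i"])
    ultimately show ?thesis by (simp add: field_simps)
  qed
  \<comment> \<open>The difference of \<open>large\<close> and \<open>err\<close>, halved.\<close>
  have tot: "\<epsilon> * F / 2 \<le> (\<Sum>i\<in>I. \<Sum>j\<in>J. y i j * \<beta> i j)"
    using sum_mono[OF col, of I "\<lambda>i. i"] large err
    by (simp add: sum_subtractf sum_divide_distrib[symmetric] algebra_simps)
  \<comment> \<open>The sum of the |y| is at most sqrt (k \<Lambda> N), and \<theta> sqrt (k
    \<Lambda>) = \<epsilon> / 4: this is where the 16 in the choice of \<open>\<theta>\<close> comes
    from.\<close>
  have small: "(\<Sum>j\<in>J. y i j * \<beta> i j) \<le> \<epsilon> * N i / 4 + (\<Sum>j\<in>J. y i j * b i j)" if i: "i \<in> I" for i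
  proof -
    have "y i j * \<beta> i j \<le> \<bar>y i j\<bar> * (\<theta> * sqrt (N i)) + y i j * b i j" for j
    proof (cases "\<theta>\<^sup>2 * N i < (\<beta> i j)\<^sup>2")
      case False
      then have "\<bar>\<beta> i j\<bar>\<^sup>2 \<le> (\<theta> * sqrt (N i))\<^sup>2" using N0 by (simp add: power_mult_distrib)
      then have "\<bar>\<beta> i j\<bar> \<le> \<theta> * sqrt (N i)" by (rule power2_le_imp_le) (use \<theta> N0 in auto)
      then have "\<bar>y i j\<bar> * \<bar>\<beta> i j\<bar> \<le> \<bar>y i j\<bar> * (\<theta> * sqrt (N i))" by (rule mult_left_mono) simp
      moreover have "y i j * \<beta> i j \<le> \<bar>y i j\<bar> * \<bar>\<beta> i j\<bar>" by (metis abs_ge_self abs_mult)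
      ultimately show ?thesis using False by (simp add: b_def)
    qed (use \<theta> N0 in \<open>simp add: b_def\<close>)
    then have "(\<Sum>j\<in>J. y i j * \<beta> i j) \<le> (\<Sum>j\<in>J. \<bar>y i j\<bar> * (\<theta> * sqrt (N i)) + y i j * b i j)"
      by (intro sum_mono)
    also have "\<dots> = (\<Sum>j\<in>J. \<bar>y i j\<bar>) * (\<theta> * sqrt (N i)) + (\<Sum>j\<in>J. y i j * b i j)"
      by (simp add: sum.distrib sum_distrib_right)
    also have "(\<Sum>j\<in>J. \<bar>y i j\<bar>) * (\<theta> * sqrt (N i)) \<le> \<epsilon> * N i / 4"
    proof (rule power2_le_imp_le)
      have "((\<Sum>j\<in>J. \<bar>y i j\<bar>) * (\<theta> * sqrt (N i)))\<^sup>2 = (\<Sum>j\<in>J. \<bar>y i j\<bar>)\<^sup>2 * (\<theta>\<^sup>2 * N i)"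
        using N0 by (simp add: power_mult_distrib)
      also have "\<dots> \<le> (k * (\<Lambda> * N i)) * (\<theta>\<^sup>2 * N i)"
        using sparse_l1_l2[OF J(1) sp[OF i]] mult_left_mono[OF yN[OF i], of "real k"] N0
        by (intro mult_right_mono) auto
      also have "\<dots> = (\<theta>\<^sup>2 * (16 * k * \<Lambda>)) * (N i)\<^sup>2 / 16" by (simp add: power2_eq_square)
      also have "\<dots> = (\<epsilon> * N i / 4)\<^sup>2" unfolding \<theta>(2) by (simp add: power2_eq_square)
      finally show "((\<Sum>j\<in>J. \<bar>y i j\<bar>) * (\<theta> * sqrt (N i)))\<^sup>2 \<le> (\<epsilon> * N i / 4)\<^sup>2" .
    qed (use pos N0 in auto)
    finally show ?thesis by simp
  qed
  have "(\<Sum>i\<in>I. \<Sum>j\<in>J. y i j * \<beta> i j) \<le> (\<Sum>i\<in>I. \<epsilon> * N i / 4 + (\<Sum>j\<in>J. y i j * b i j))"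
    by (rule sum_mono) (rule small)
  with tot have b1: "\<epsilon> * F / 4 \<le> (\<Sum>i\<in>I. \<Sum>j\<in>J. y i j * b i j)"
    by (simp add: sum.distrib F sum_distrib_left sum_divide_distrib[symmetric])
  have "(\<Sum>j\<in>J. y i j * b i j) \<le> \<epsilon> / 8 * N i + 2 * \<Lambda> / \<epsilon> * (\<Sum>j\<in>J. (b i j)\<^sup>2)" if i: "i \<in> I" for i
  proof -
    \<comment> \<open>With this parameter the first term sums to at most
      \<open>\<epsilon> / 8 * N i\<close>, half of the \<open>\<epsilon> / 4\<close> that is
      available.\<close>
    have "y i j * b i j \<le> \<epsilon> / (8 * \<Lambda>) * (y i j)\<^sup>2 + 2 * \<Lambda> / \<epsilon> * (b i j)\<^sup>2" for j
      using young[of "\<epsilon> / (4 * \<Lambda>)" "y i j" "b i j"] pos by (simp add: field_simps)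
    then have "(\<Sum>j\<in>J. y i j * b i j)
        \<le> (\<Sum>j\<in>J. \<epsilon> / (8 * \<Lambda>) * (y i j)\<^sup>2 + 2 * \<Lambda> / \<epsilon> * (b i j)\<^sup>2)" by (intro sum_mono)
    also have "\<dots> = \<epsilon> / (8 * \<Lambda>) * (\<Sum>j\<in>J. (y i j)\<^sup>2) + 2 * \<Lambda> / \<epsilon> * (\<Sum>j\<in>J. (b i j)\<^sup>2)"
      by (simp add: sum.distrib sum_distrib_left)
    also have "\<epsilon> / (8 * \<Lambda>) * (\<Sum>j\<in>J. (y i j)\<^sup>2) \<le> \<epsilon> / (8 * \<Lambda>) * (\<Lambda> * N i)"
      using yN[OF i] pos by (intro mult_left_mono) auto
    finally show ?thesis using pos by simp
  qed
  then have "(\<Sum>i\<in>I. \<Sum>j\<in>J. y i j * b i j)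
      \<le> (\<Sum>i\<in>I. \<epsilon> / 8 * N i + 2 * \<Lambda> / \<epsilon> * (\<Sum>j\<in>J. (b i j)\<^sup>2))" by (intro sum_mono)
  also have "\<dots> = \<epsilon> / 8 * F + 2 * \<Lambda> / \<epsilon> * (\<Sum>i\<in>I. \<Sum>j\<in>J. (b i j)\<^sup>2)"
    by (simp add: sum.distrib F sum_distrib_left)
  also have "(\<Sum>i\<in>I. \<Sum>j\<in>J. (b i j)\<^sup>2) = (\<Sum>j\<in>J. \<Sum>i\<in>I. (b i j)\<^sup>2)" by (rule sum.swap)
  finally have "\<epsilon> * F / 8 \<le> 2 * \<Lambda> / \<epsilon> * (\<Sum>j\<in>J. \<Sum>i\<in>I. (b i j)\<^sup>2)" using b1 by simp
  then have tot_S: "\<epsilon>\<^sup>2 * F \<le> 16 * \<Lambda> * (\<Sum>j\<in>J. \<Sum>i\<in>I. (b i j)\<^sup>2)"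
    using pos by (simp add: field_simps power2_eq_square)
  \<comment> \<open>Otherwise every atom stays below its share 1 / \<open>card J\<close> of the
    total.\<close>
  have "\<exists>j\<in>J. \<epsilon>\<^sup>2 * F \<le> 16 * \<Lambda> * card J * (\<Sum>i\<in>I. (b i j)\<^sup>2)"
  proof (rule ccontr)
    assume "\<not> ?thesis"
    then have "(\<Sum>j\<in>J. 16 * \<Lambda> * card J * (\<Sum>i\<in>I. (b i j)\<^sup>2)) < (\<Sum>j\<in>J. \<epsilon>\<^sup>2 * F)"
      using J by (intro sum_strict_mono) auto
    then have "card J * (16 * \<Lambda> * (\<Sum>j\<in>J. \<Sum>i\<in>I. (b i j)\<^sup>2)) < card J * (\<epsilon>\<^sup>2 * F)"
      by (simp add: sum_distrib_left mult_ac)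
    with tot_S show False by (simp add: mult_less_cancel_left)
  qed
  then obtain j where "j \<in> J" "\<epsilon>\<^sup>2 * F \<le> 16 * \<Lambda> * card J * (\<Sum>i\<in>I. (b i j)\<^sup>2)" by blast
  moreover have "(\<Sum>i\<in>I. (b i j)\<^sup>2)
      = (\<Sum>i\<in>I. if \<theta>\<^sup>2 * N i < (dot D (r i) (a j))\<^sup>2 then (dot D (r i) (a j))\<^sup>2 else 0)"
    by (intro sum.cong) (auto simp: b_def \<beta>_def)
  ultimately show ?thesis using that by simp
qed

text \<open>The unknown atom \<open>a j\<close> only certifies that the weighted sum of the
  residuals is long: its component along this unit vector is \<open>S\<close>. Hence some known
  residual serves as well, at the price of another factor \<open>\<theta>\<^sup>2 / 4\<close>. The
  constants combine to 16 * 64 = 1024.\<close>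

lemma gain_lower_bound:
  fixes x r :: "'i \<Rightarrow> 'a \<Rightarrow> real" and a :: "'j \<Rightarrow> 'a \<Rightarrow> real" and y :: "'i \<Rightarrow> 'j \<Rightarrow> real"
    and \<Lambda> \<epsilon> \<gamma> :: real and k :: nat
  assumes J: "finite J" "J \<noteq> {}" and pos: "0 < \<Lambda>" "0 < \<epsilon>" "0 < k"
    and unit: "\<And>j. j \<in> J \<Longrightarrow> dot D (a j) (a j) = 1"
    and N: "\<And>i. N i = dot D (x i) (x i)" and F: "F = (\<Sum>i\<in>I. N i)"
    and rx: "\<And>i. i \<in> I \<Longrightarrow> dot D (r i) (x i) = dot D (r i) (r i)"
    and sp: "\<And>i. i \<in> I \<Longrightarrow> card {j\<in>J. y i j \<noteq> 0} \<le> k"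
    and yN: "\<And>i. i \<in> I \<Longrightarrow> (\<Sum>j\<in>J. (y i j)\<^sup>2) \<le> \<Lambda> * N i"
    and err: "(\<Sum>i\<in>I. dot D (\<lambda>b. x i b - (\<Sum>j\<in>J. y i j * a j b)) (\<lambda>b. x i b - (\<Sum>j\<in>J. y i j * a j b)))
      \<le> \<gamma> * F"
    and large: "(\<gamma> + \<epsilon>) * F \<le> (\<Sum>i\<in>I. dot D (r i) (r i))"
    and c: "c = \<epsilon> ^ 4 / (1024 * real k ^ 2 * \<Lambda> ^ 2)"
    and g: "0 \<le> g" "\<And>l. l \<in> I \<Longrightarrow> gain D I c N r (r l) \<le> g"
  shows "\<epsilon> ^ 4 * F \<le> 1024 * \<Lambda> ^ 2 * card J * k * g"
proof -
  define \<theta> where "\<theta> = \<epsilon> / (4 * sqrt (k * \<Lambda>))"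
  have \<theta>: "0 < \<theta>" "\<theta>\<^sup>2 * (16 * k * \<Lambda>) = \<epsilon>\<^sup>2"
    using pos by (auto simp: \<theta>_def power_divide power_mult_distrib)
  obtain j where j: "j \<in> J" and S: "\<epsilon>\<^sup>2 * F \<le> 16 * \<Lambda> * card J *
      (\<Sum>i\<in>I. if \<theta>\<^sup>2 * N i < (dot D (r i) (a j))\<^sup>2 then (dot D (r i) (a j))\<^sup>2 else 0)"
    by (rule exists_correlated_atom[where J = J and \<Lambda> = \<Lambda> and \<epsilon> = \<epsilon> and k = k and N = N
      and D = D and x = x and F = F and I = I and r = r and y = y and a = a and \<gamma> = \<gamma> and \<theta> = \<theta>])
      (use assms \<theta> in auto)
  define w where "w i = (if \<theta>\<^sup>2 * N i < (dot D (r i) (a j))\<^sup>2 then dot D (r i) (a j) else 0)" for i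
  define S where "S = (\<Sum>i\<in>I. (w i)\<^sup>2)"
  have S_eq: "(\<Sum>i\<in>I. if \<theta>\<^sup>2 * N i < (dot D (r i) (a j))\<^sup>2 then (dot D (r i) (a j))\<^sup>2 else 0) = S"
    unfolding S_def by (intro sum.cong) (auto simp: w_def)
  let ?v = "\<lambda>b. \<Sum>i\<in>I. w i * r i b"
  have "dot D ?v (a j) = (\<Sum>i\<in>I. w i * dot D (r i) (a j))" by (rule dot_sum_left)
  also have "\<dots> = S" unfolding S_def by (intro sum.cong) (auto simp: w_def power2_eq_square)
  finally have "S\<^sup>2 \<le> dot D ?v ?v"
    using Cauchy_Schwarz_dot[of D ?v "a j"] unit[OF j] by simp
  also have "\<dots> = (\<Sum>l\<in>I. \<Sum>i\<in>I. w l * w i * dot D (r l) (r i))"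
    unfolding dot_sum_left by (simp add: dot_sum_right sum_distrib_left mult.assoc)
  finally have V: "S\<^sup>2 \<le> (\<Sum>l\<in>I. \<Sum>i\<in>I. w l * w i * dot D (r l) (r i))" .
  \<comment> \<open>Cauchy-Schwarz for \<open>dot D (r i) (x i)\<close>, which equals
    \<open>dot D (r i) (r i)\<close>.\<close>
  have rN: "dot D (r i) (r i) \<le> N i" if "i \<in> I" for i
    using Cauchy_Schwarz_dot[of D "r i" "x i"] rx[OF that] N[of i]
    by (cases "dot D (r i) (r i) = 0") (auto simp: power2_eq_square less_le)
  have "\<theta>\<^sup>2 * S \<le> 4 * g"
  \<comment> \<open>This is the largest \<open>\<kappa>\<close> permitted. Its square is exactly
    \<open>c\<close>, whence the 1024 there.\<close>
  proof (rule gain_ge_of_weights[where \<kappa> = "\<theta>\<^sup>2 / 2"])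
    have "\<theta>\<^sup>2 = \<epsilon>\<^sup>2 / (16 * k * \<Lambda>)" using \<theta>(2) pos by (simp add: field_simps)
    then show "c = (\<theta>\<^sup>2 / 2)\<^sup>2" by (simp add: c power2_eq_square power4_eq_xxxx mult_ac)
    show "w i = 0 \<or> \<theta>\<^sup>2 * N i \<le> (w i)\<^sup>2" for i by (auto simp: w_def)
  qed (use \<theta> rN V S_def g in auto)
  then have "16 * real k * \<Lambda> * (\<theta>\<^sup>2 * S) \<le> 16 * real k * \<Lambda> * (4 * g)"
    using pos by (intro mult_left_mono) auto
  then have "\<epsilon>\<^sup>2 * S \<le> 64 * k * \<Lambda> * g"
    unfolding \<theta>(2)[symmetric] by (simp add: mult_ac)
  then have "16 * \<Lambda> * card J * (\<epsilon>\<^sup>2 * S) \<le> 16 * \<Lambda> * card J * (64 * k * \<Lambda> * g)"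
    using pos by (intro mult_left_mono) auto
  moreover have "\<epsilon>\<^sup>2 * (\<epsilon>\<^sup>2 * F) \<le> \<epsilon>\<^sup>2 * (16 * \<Lambda> * card J * S)"
    using S unfolding S_eq by (rule mult_left_mono) simp
  ultimately show ?thesis by (simp add: power2_eq_square power4_eq_xxxx mult_ac)
qed

text \<open>For an approximation v of x, |x - v|^2 is at least |x|^2 - 2 <x, v>, and 2 <x, v> \<le>
  \<epsilon> |x|^2 + |v|^2 / \<epsilon>. Unit atoms and sparsity bound |v|^2 by k \<Lambda> |x|^2.
  The target error is therefore never far below the initial error \<open>F\<close>, which caps the
  number of rounds.\<close>

lemma excess_le:
  fixes x :: "'i \<Rightarrow> 'a \<Rightarrow> real" and a :: "'j \<Rightarrow> 'a \<Rightarrow> real" and y :: "'i \<Rightarrow> 'j \<Rightarrow> real"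
    and \<Lambda> \<epsilon> \<gamma> :: real and k :: nat
  assumes J: "finite J" and pos: "0 < \<Lambda>" "0 < \<epsilon>"
    and unit: "\<And>j. j \<in> J \<Longrightarrow> dot D (a j) (a j) = 1"
    and N: "\<And>i. N i = dot D (x i) (x i)" and F: "F = (\<Sum>i\<in>I. N i)"
    and sp: "\<And>i. i \<in> I \<Longrightarrow> card {j\<in>J. y i j \<noteq> 0} \<le> k"
    and yN: "\<And>i. i \<in> I \<Longrightarrow> (\<Sum>j\<in>J. (y i j)\<^sup>2) \<le> \<Lambda> * N i"
    and err: "(\<Sum>i\<in>I. dot D (\<lambda>b. x i b - (\<Sum>j\<in>J. y i j * a j b)) (\<lambda>b. x i b - (\<Sum>j\<in>J. y i j * a j b)))
      \<le> \<gamma> * F"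
  shows "F - k * \<Lambda> / \<epsilon> * F \<le> (\<gamma> + \<epsilon>) * F"
proof -
  have "(1 - \<epsilon> - k * \<Lambda> / \<epsilon>) * N i \<le> dot D (\<lambda>b. x i b - (\<Sum>j\<in>J. y i j * a j b))
      (\<lambda>b. x i b - (\<Sum>j\<in>J. y i j * a j b))" if i: "i \<in> I" for i
  proof -
    let ?v = "\<lambda>b. \<Sum>j\<in>J. y i j * a j b"
    have "dot D ?v ?v = (\<Sum>l\<in>J. \<Sum>j\<in>J. y i l * (y i j * dot D (a l) (a j)))"
      unfolding dot_sum_left by (simp add: dot_sum_right sum_distrib_left)
    also have "\<dots> \<le> (\<Sum>l\<in>J. \<Sum>j\<in>J. \<bar>y i l\<bar> * \<bar>y i j\<bar>)"
    proof (intro sum_mono)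
      fix l j assume "l \<in> J" "j \<in> J"
      then have "\<bar>dot D (a l) (a j)\<bar> \<le> 1"
        using Cauchy_Schwarz_dot[of D "a l" "a j"] unit by (simp add: abs_square_le_1)
      then have "\<bar>y i l\<bar> * \<bar>y i j\<bar> * \<bar>dot D (a l) (a j)\<bar> \<le> \<bar>y i l\<bar> * \<bar>y i j\<bar> * 1"
        by (rule mult_left_mono) simp
      then show "y i l * (y i j * dot D (a l) (a j)) \<le> \<bar>y i l\<bar> * \<bar>y i j\<bar>"
        using abs_ge_self[of "y i l * (y i j * dot D (a l) (a j))"] by (simp add: abs_mult mult.assoc)
    qed
    also have "\<dots> = (\<Sum>j\<in>J. \<bar>y i j\<bar>)\<^sup>2" by (simp add: power2_eq_square sum_product)
    also have "\<dots> \<le> k * (\<Lambda> * N i)"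
      using sparse_l1_l2[OF J sp[OF i]] mult_left_mono[OF yN[OF i], of "real k"] by simp
    finally have v: "dot D ?v ?v \<le> k * \<Lambda> * N i" by simp
    have "0 \<le> dot D (\<lambda>b. \<epsilon> * x i b - ?v b) (\<lambda>b. \<epsilon> * x i b - ?v b)" by (rule dot_self_nonneg)
    also have "\<dots> = \<epsilon> * (\<epsilon> * N i) - 2 * \<epsilon> * dot D (x i) ?v + dot D ?v ?v"
      by (subst dot_diff_left, subst dot_diff_right, subst dot_diff_right)
        (simp add: dot_scale_left dot_scale_right N dot_commute[of D ?v "x i"])
    finally have "\<epsilon> * (2 * dot D (x i) ?v) \<le> \<epsilon> * (\<epsilon> * N i) + k * \<Lambda> * N i" using v by simp
    then have "2 * dot D (x i) ?v \<le> \<epsilon> * N i + k * \<Lambda> / \<epsilon> * N i"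
      using pos by (simp add: field_simps)
    moreover have "dot D (\<lambda>b. x i b - ?v b) (\<lambda>b. x i b - ?v b)
        = N i - 2 * dot D (x i) ?v + dot D ?v ?v"
      by (subst dot_diff_left, subst dot_diff_right, subst dot_diff_right)
        (simp add: N dot_commute[of D ?v "x i"])
    ultimately show ?thesis using dot_self_nonneg[of D ?v] unfolding left_diff_distrib by linarith
  qed
  then have "(\<Sum>i\<in>I. (1 - \<epsilon> - k * \<Lambda> / \<epsilon>) * N i) \<le> \<gamma> * F"
    by (intro order_trans[OF sum_mono err])
  then have "(1 - \<epsilon> - k * \<Lambda> / \<epsilon>) * F \<le> \<gamma> * F" by (simp only: F sum_distrib_left)
  then show ?thesis by (simp add: algebra_simps)
qed

text \<open>Replacing \<open>q\<close> by the projection of \<open>x\<close> to its span restores the orthogonality of residual and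
  approximation. If \<open>z\<close> or \<open>q\<close> vanishes, then \<open>y\<close> or \<open>t\<close> is \<open>0 / 0 = 0\<close>, and the claims still hold.\<close>

lemma rescaled_step:
  assumes orth: "dot D (\<lambda>b. x b - p b) p = 0"
    and y: "y = dot D z (\<lambda>b. x b - p b) / dot D z z"
    and q: "\<And>b. b \<in> D \<Longrightarrow> q b = p b + y * z b"
    and t: "t = dot D x q / dot D q q"
    and p': "\<And>b. b \<in> D \<Longrightarrow> p' b = t * q b"
  shows "dot D (\<lambda>b. x b - p' b) p' = 0"
    and "dot D (\<lambda>b. x b - p' b) (\<lambda>b. x b - p' b)
      \<le> dot D (\<lambda>b. x b - p b) (\<lambda>b. x b - p b) - (dot D z (\<lambda>b. x b - p b))\<^sup>2 / dot D z z"
proof -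
  have cong: "dot D u v = dot D u' v'" if "\<And>b. b \<in> D \<Longrightarrow> u b = u' b" "\<And>b. b \<in> D \<Longrightarrow> v b = v' b"
    for u v u' v' using that by (simp add: dot_def)
  have tq: "t * dot D q q = dot D x q"
    using t dot_self_eq_0[of D q x] by (auto simp: dot_commute)
  have "dot D (\<lambda>b. x b - p' b) p' = dot D (\<lambda>b. x b - t * q b) (\<lambda>b. t * q b)"
    by (rule cong) (simp_all add: p')
  also have "\<dots> = t * (dot D x q - t * dot D q q)" by (simp add: dot_simps algebra_simps)
  finally show "dot D (\<lambda>b. x b - p' b) p' = 0" using tq by simp
  let ?r = "\<lambda>b. x b - p b"
  have zr: "y * dot D z z = dot D z ?r"
    using y dot_self_eq_0[of D z ?r] by auto
  have "dot D (\<lambda>b. x b - p' b) (\<lambda>b. x b - p' b) = dot D (\<lambda>b. x b - t * q b) (\<lambda>b. x b - t * q b)"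
    by (rule cong) (simp_all add: p')
  also have "\<dots> = dot D x x - 2 * t * dot D x q + t * (t * dot D q q)"
    by (simp add: dot_simps dot_commute[of D q x] algebra_simps)
  \<comment> \<open>\<open>t\<close> is the best multiple of \<open>q\<close>, hence no worse than
    the multiple 1.\<close>
  also have "\<dots> \<le> dot D x x - 2 * dot D x q + dot D q q"
  proof -
    have "0 \<le> (t - 1)\<^sup>2 * dot D q q" by simp
    then show ?thesis using tq by (simp add: power2_eq_square algebra_simps)
  qed
  also have "\<dots> = dot D (\<lambda>b. x b - q b) (\<lambda>b. x b - q b)"
    by (simp add: dot_simps dot_commute[of D q x])
  also have "\<dots> = dot D (\<lambda>b. ?r b - y * z b) (\<lambda>b. ?r b - y * z b)"
    by (rule cong) (simp_all add: q)
  also have "\<dots> = dot D ?r ?r - 2 * y * dot D z ?r + y * (y * dot D z z)"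
    by (subst dot_diff_left, subst dot_diff_right, subst dot_diff_right)
      (simp add: dot_scale_left dot_scale_right dot_commute[of D ?r z])
  also have "\<dots> = dot D ?r ?r - (dot D z ?r)\<^sup>2 / dot D z z"
    unfolding zr by (simp add: y power2_eq_square)
  finally show "dot D (\<lambda>b. x b - p' b) (\<lambda>b. x b - p' b)
      \<le> dot D ?r ?r - (dot D z ?r)\<^sup>2 / dot D z z" .
qed

section \<open>The invariant of a single column\<close>

text \<open>\<open>x\<close>, \<open>p\<close> and \<open>y\<close> are the same column of the input, of the current product \<open>A Y\<close> and of \<open>Y\<close>.
  The last clause pays for each nonzero entry of \<open>y\<close> with a decrease of the squared error. It
  says nothing about \<open>y\<close> if \<open>x = 0\<close>, whence the clause before it.\<close>

definition column_inv ::
    "nat \<Rightarrow> real \<Rightarrow> (nat \<Rightarrow> nat \<Rightarrow> real) \<Rightarrow> nat \<Rightarrow> (nat \<Rightarrow> real) \<Rightarrow> (nat \<Rightarrow> real) \<Rightarrow> (nat \<Rightarrow> real) \<Rightarrow> bool" where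
  "column_inv d c A M x p y \<longleftrightarrow>
    (\<forall>a<d. p a = (\<Sum>h<M. y h * A a h)) \<and>
    dot {..<d} (\<lambda>a. x a - p a) p = 0 \<and>
    (\<forall>h\<ge>M. y h = 0) \<and> (dot {..<d} x x = 0 \<longrightarrow> (\<forall>h. y h = 0)) \<and>
    dot {..<d} (\<lambda>a. x a - p a) (\<lambda>a. x a - p a)
      + c * dot {..<d} x x * card {h. h < M \<and> y h \<noteq> 0} \<le> dot {..<d} x x"

lemma column_inv_init: "column_inv d c A 0 x (\<lambda>_. 0) (\<lambda>_. 0)"
  by (simp add: column_inv_def dot_def)

lemma column_inv_cong:
  "column_inv d c A M x p y \<Longrightarrow> (\<And>a h. a < d \<Longrightarrow> h < M \<Longrightarrow> A' a h = A a h) \<Longrightarrow> column_inv d c A' M x p y"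
  by (simp add: column_inv_def)

text \<open>Covers the columns that a round leaves alone: their entry in the new row
  \<open>M\<close> is still zero.\<close>

lemma column_inv_Suc: "column_inv d c A M x p y \<Longrightarrow> column_inv d c A (Suc M) x p y"
proof -
  assume I: "column_inv d c A M x p y"
  then have "y M = 0" by (simp add: column_inv_def)
  then have "{h. h < Suc M \<and> y h \<noteq> 0} = {h. h < M \<and> y h \<noteq> 0}" using less_Suc_eq by auto
  with I \<open>y M = 0\<close> show ?thesis by (simp add: column_inv_def)
qed

text \<open>The error of a column that passes the test drops by more than
  \<open>c * dot {..<d} x x\<close>. This pays for the only entry that can become nonzero, the one
  in row \<open>M\<close>; scaling by \<open>t\<close> creates no others.\<close>

lemma column_inv_step:
  assumes I: "column_inv d c A M x p y" and c: "0 \<le> c"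
    and zz: "zz = dot {..<d} (\<lambda>a. A a M) (\<lambda>a. A a M)"
    and zr: "zr = dot {..<d} (\<lambda>a. A a M) (\<lambda>a. x a - p a)"
    and test: "c * zz * dot {..<d} x x < zr\<^sup>2"
    and q: "\<And>a. a < d \<Longrightarrow> q a = p a + zr / zz * A a M"
    and t: "t = dot {..<d} x q / dot {..<d} q q"
    and p': "\<And>a. a < d \<Longrightarrow> p' a = t * q a"
    and y': "\<And>h. y' h = (if h < Suc M then t * (y(M := zr / zz)) h else y h)"
  shows "column_inv d c A (Suc M) x p' y'"
    and "dot {..<d} (\<lambda>a. x a - p' a) (\<lambda>a. x a - p' a)
      \<le> dot {..<d} (\<lambda>a. x a - p a) (\<lambda>a. x a - p a) - zr\<^sup>2 / zz"
proof -
  have y0: "y h = 0" if "h \<ge> M" for h using I that by (simp add: column_inv_def)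
  note step = rescaled_step[where D = "{..<d}" and x = x and p = p and y = "zr / zz"
      and z = "\<lambda>a. A a M" and q = q and t = t and p' = p']
  have orth: "dot {..<d} (\<lambda>a. x a - p' a) p' = 0"
    by (rule step(1)) (use I zz zr q t p' in \<open>auto simp: column_inv_def\<close>)
  show drop: "dot {..<d} (\<lambda>a. x a - p' a) (\<lambda>a. x a - p' a)
      \<le> dot {..<d} (\<lambda>a. x a - p a) (\<lambda>a. x a - p a) - zr\<^sup>2 / zz"
    unfolding zr zz
    by (rule step(2)) (use I zz zr q t p' in \<open>auto simp: column_inv_def\<close>)
  have "zz \<noteq> 0" using test zz zr dot_self_eq_0[of "{..<d}" "\<lambda>a. A a M"] by auto
  then have "0 < zz" using zz by (simp add: less_le)
  then have gain: "c * dot {..<d} x x \<le> zr\<^sup>2 / zz" using test by (simp add: field_simps)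
  have "{h. h < Suc M \<and> y' h \<noteq> 0} \<subseteq> insert M {h. h < M \<and> y h \<noteq> 0}"
    using y' by (auto simp: less_Suc_eq)
  then have "card {h. h < Suc M \<and> y' h \<noteq> 0} \<le> card (insert M {h. h < M \<and> y h \<noteq> 0})"
    by (intro card_mono) auto
  also have "\<dots> \<le> card {h. h < M \<and> y h \<noteq> 0} + 1" by (simp add: card_insert_if)
  finally have "real (card {h. h < Suc M \<and> y' h \<noteq> 0}) \<le> card {h. h < M \<and> y h \<noteq> 0} + 1" by linarith
  then have "c * dot {..<d} x x * card {h. h < Suc M \<and> y' h \<noteq> 0}
      \<le> c * dot {..<d} x x * (card {h. h < M \<and> y h \<noteq> 0} + 1)"
    using c by (intro mult_left_mono) auto
  also have "\<dots> = c * dot {..<d} x x * card {h. h < M \<and> y h \<noteq> 0} + c * dot {..<d} x x"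
    by (simp add: algebra_simps)
  finally have count: "dot {..<d} (\<lambda>a. x a - p' a) (\<lambda>a. x a - p' a)
      + c * dot {..<d} x x * card {h. h < Suc M \<and> y' h \<noteq> 0} \<le> dot {..<d} x x"
    using I drop gain unfolding column_inv_def by linarith
  have "p' a = (\<Sum>h<Suc M. y' h * A a h)" if a: "a < d" for a
  proof -
    have "p a = (\<Sum>h<M. y h * A a h)" using I a by (simp add: column_inv_def)
    then have "p' a = t * ((\<Sum>h<M. y h * A a h) + zr / zz * A a M)" using p' q a by simp
    then show ?thesis by (simp add: y' algebra_simps sum_distrib_left)
  qed
  \<comment> \<open>For a zero column the invariant forces a zero residual and the test reads
    \<open>0 < 0\<close>. So the clause on zero columns holds vacuously afterwards.\<close>
  moreover have "dot {..<d} x x \<noteq> 0"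
  proof
    assume x: "dot {..<d} x x = 0"
    then have "dot {..<d} (\<lambda>a. x a - p a) (\<lambda>a. x a - p a) = 0"
      using I dot_self_nonneg[of "{..<d}" "\<lambda>a. x a - p a"] by (simp add: column_inv_def)
    then have "zr = 0" using dot_self_eq_0 zr by (metis dot_commute)
    with x test show False by simp
  qed
  ultimately show "column_inv d c A (Suc M) x p' y'" using orth count y0 y' by (simp add: column_inv_def)
qed

text \<open>Each nonzero entry has cost \<open>c * dot {..<d} x x\<close> out of a budget of
  \<open>dot {..<d} x x\<close>. For a zero column, where entries are free, the clause that
  \<open>y\<close> vanishes takes over.\<close>

lemma column_inv_card:
  assumes "column_inv d c A M x p y" "0 < c"
  shows "card {h. h < M \<and> y h \<noteq> 0} \<le> 1 / c"
proof (cases "dot {..<d} x x = 0")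
  case False
  then have x: "0 < dot {..<d} x x" by (simp add: less_le)
  have "c * dot {..<d} x x * card {h. h < M \<and> y h \<noteq> 0} \<le> dot {..<d} x x"
    using assms(1) dot_self_nonneg[of "{..<d}" "\<lambda>a. x a - p a"] unfolding column_inv_def by linarith
  then have "dot {..<d} x x * (c * card {h. h < M \<and> y h \<noteq> 0}) \<le> dot {..<d} x x * 1"
    by (simp add: mult_ac)
  with x assms(2) show ?thesis by (simp add: field_simps)
qed (use assms in \<open>simp add: column_inv_def\<close>)

text \<open>The residual is orthogonal to \<open>p\<close>, so it pairs with \<open>x\<close> as
  with itself. This supplies the hypothesis \<open>rx\<close> of
  \<open>gain_lower_bound\<close>.\<close>

lemma column_inv_orth:
  assumes "column_inv d c A M x p y"
  shows "dot {..<d} (\<lambda>a. x a - p a) x = dot {..<d} (\<lambda>a. x a - p a) (\<lambda>a. x a - p a)"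
  using assms by (simp add: column_inv_def dot_diff_right[of _ "\<lambda>a. x a - p a"])

lemma gain_cong:
  assumes "\<And>i. i \<in> I \<Longrightarrow> N i = N' i" "\<And>a. a \<in> D \<Longrightarrow> z a = z' a"
  shows "gain D I c N r z = gain D I c N' r z'"
proof -
  have "dot D z v = dot D z' v" for v using assms(2) by (simp add: dot_def)
  moreover have "dot D z z = dot D z' z'" using assms(2) by (simp add: dot_def)
  ultimately show ?thesis unfolding gain_def using assms(1) by (intro sum.cong) auto
qed

text \<open>Lets the loop over the columns credit each column with its own share of the
  gain.\<close>

lemma gain_eq_sum_singletons: "gain D I c N r z = (\<Sum>i\<in>I. gain D {i} c N r z)"
  by (simp add: gain_def)

section \<open>Total correctness with running times\<close>

text \<open>The store is the last argument, so \<open>tot Q U R\<close> is itself a postcondition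
  and sequences nest like weakest preconditions.\<close>

definition tot :: "com \<Rightarrow> nat \<Rightarrow> (store \<Rightarrow> bool) \<Rightarrow> store \<Rightarrow> bool" where
  "tot P T Q s \<longleftrightarrow> (\<exists>t s'. exec P s t s' \<and> t \<le> T \<and> Q s')"

section \<open>Frames: names that a program leaves unchanged\<close>

fun written_regs :: "com \<Rightarrow> name set" where
  "written_regs Skip = {}"
| "written_regs (SetReg x a) = {x}"
| "written_regs (SetCell x i j a) = {}"
| "written_regs (Seq P Q) = written_regs P \<union> written_regs Q"
| "written_regs (Cond b P Q) = written_regs P \<union> written_regs Q"
| "written_regs (Loop b P) = written_regs P"

fun written_arrs :: "com \<Rightarrow> name set" where
  "written_arrs Skip = {}"
| "written_arrs (SetReg x a) = {}"
| "written_arrs (SetCell x i j a) = {x}"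
| "written_arrs (Seq P Q) = written_arrs P \<union> written_arrs Q"
| "written_arrs (Cond b P Q) = written_arrs P \<union> written_arrs Q"
| "written_arrs (Loop b P) = written_arrs P"

definition frame :: "name set \<Rightarrow> name set \<Rightarrow> store \<Rightarrow> store \<Rightarrow> bool" where
  "frame W V s s' \<longleftrightarrow> (\<forall>x. x \<notin> W \<longrightarrow> reg s' x = reg s x) \<and> (\<forall>x. x \<notin> V \<longrightarrow> arr s' x = arr s x)"

lemma frame_reg: "frame W V s s' \<Longrightarrow> x \<notin> W \<Longrightarrow> reg s' x = reg s x"
  by (simp add: frame_def)

lemma frame_arr: "frame W V s s' \<Longrightarrow> x \<notin> V \<Longrightarrow> arr s' x = arr s x"
  by (simp add: frame_def)

lemma frame_trans: "frame W V s s' \<Longrightarrow> frame W V s' s'' \<Longrightarrow> frame W V s s''"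
  by (simp add: frame_def)

lemma frame_mono: "frame W V s s' \<Longrightarrow> W \<subseteq> W' \<Longrightarrow> V \<subseteq> V' \<Longrightarrow> frame W' V' s s'"
  by (auto simp: frame_def)

lemma reg_set_reg [simp]: "reg (set_reg x c s) y = (if y = x then c else reg s y)"
  by (simp add: set_reg_def)

lemma arr_set_reg [simp]: "arr (set_reg x c s) = arr s"
  by (simp add: set_reg_def)

lemma reg_set_cell [simp]: "reg (set_cell x i j c s) = reg s"
  by (simp add: set_cell_def)

lemma arr_set_cell [simp]:
  "arr (set_cell x i j c s) y = (if y = x then (arr s x)(i := (arr s x i)(j := c)) else arr s y)"
  by (simp add: set_cell_def)

lemma exec_frame: "exec P s t s' \<Longrightarrow> frame (written_regs P) (written_arrs P) s s'"
proof (induction rule: exec.induct)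
  case (Seq P s t s' Q u s'')
  then show ?case
    by (intro frame_trans[of _ _ s s' s'']) (auto elim: frame_mono)
next
  case (LoopTrue b s P t s' u s'')
  then show ?case
    by (intro frame_trans[of _ _ s s' s'']) auto
qed (auto simp: frame_def)

section \<open>Proof rules for the program constructs\<close>

lemma tot_mono:
  "tot P T Q s \<Longrightarrow> T \<le> T' \<Longrightarrow> (\<And>s'. Q s' \<Longrightarrow> Q' s') \<Longrightarrow> tot P T' Q' s"
  unfolding tot_def by (meson le_trans)

text \<open>Strengthens a postcondition by what the program text shows: names that are never
  assigned keep their values. Specifications then mention only what changes.\<close>

lemma tot_frame:
  assumes "tot P T Q s" "T \<le> T'"
    and "\<And>s'. frame (written_regs P) (written_arrs P) s s' \<Longrightarrow> Q s' \<Longrightarrow> Q' s'"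
  shows "tot P T' Q' s"
  using assms exec_frame unfolding tot_def by (meson le_trans)

lemma tot_Skip: "Q s \<Longrightarrow> 1 \<le> T \<Longrightarrow> tot Skip T Q s"
  unfolding tot_def using exec.Skip by blast

lemma tot_SetReg: "Q (set_reg x (ival a s) s) \<Longrightarrow> 1 \<le> T \<Longrightarrow> tot (SetReg x a) T Q s"
  unfolding tot_def using exec.SetReg by blast

lemma tot_SetCell:
  "Q (set_cell x (ival i s) (ival j s) (rval a s) s) \<Longrightarrow> 1 \<le> T \<Longrightarrow> tot (SetCell x i j a) T Q s"
  unfolding tot_def using exec.SetCell by blast

lemma tot_Seq: "tot P T (tot Q U R) s \<Longrightarrow> T + U \<le> V \<Longrightarrow> tot (Seq P Q) V R s"
  unfolding tot_def by (meson exec.Seq add_mono le_trans)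

lemma tot_Cond:
  assumes "bval b s \<Longrightarrow> tot P T R s" "\<not> bval b s \<Longrightarrow> tot Q T R s" "T + 1 \<le> V"
  shows "tot (Cond b P Q) V R s"
proof (cases "bval b s")
  case True
  then obtain t s' where "exec P s t s'" "t \<le> T" "R s'"
    using assms(1) by (auto simp: tot_def)
  then show ?thesis
    using exec.CondTrue[OF True] assms(3) unfolding tot_def by (meson add_le_mono1 le_trans)
next
  case False
  then obtain t s' where "exec Q s t s'" "t \<le> T" "R s'"
    using assms(2) by (auto simp: tot_def)
  then show ?thesis
    using exec.CondFalse[OF False] assms(3) unfolding tot_def by (meson add_le_mono1 le_trans)
qed

text \<open>\<open>Inv\<close> is indexed by the number of completed rounds, so the test has to
  agree with \<open>j < N\<close>. Each round costs its body and one test; the final 1 is the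
  failing test.\<close>

lemma tot_Loop:
  assumes "Inv j s" "j \<le> N"
    and test: "\<And>j s. Inv j s \<Longrightarrow> j \<le> N \<Longrightarrow> bval b s \<longleftrightarrow> j < N"
    and body: "\<And>j s. Inv j s \<Longrightarrow> j < N \<Longrightarrow> tot P T (Inv (Suc j)) s"
  shows "tot (Loop b P) ((N - j) * (T + 1) + 1) (Inv N) s"
  using assms(1,2)
proof (induction "N - j" arbitrary: j s)
  case 0
  then have "j = N" "\<not> bval b s" using test by auto
  with 0 show ?case unfolding tot_def using exec.LoopFalse by fastforce
next
  case (Suc r)
  then have j: "j < N" by simp
  with Suc.prems test have b: "bval b s" by simp
  from body[OF Suc.prems(1) j] obtain t s1 where 1: "exec P s t s1" "t \<le> T" "Inv (Suc j) s1"
    by (auto simp: tot_def)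
  have "tot (Loop b P) ((N - Suc j) * (T + 1) + 1) (Inv N) s1"
    using Suc.hyps j 1(3) by (intro Suc.hyps(1)) auto
  then obtain u s2 where 2: "exec (Loop b P) s1 u s2" "u \<le> (N - Suc j) * (T + 1) + 1" "Inv N s2"
    unfolding tot_def by blast
  have "(N - j) * (T + 1) = (N - Suc j) * (T + 1) + (T + 1)"
    using j by (metis Suc_diff_Suc add.commute mult_Suc)
  with 1 2 have "t + u + 1 \<le> (N - j) * (T + 1) + 1" by linarith
  with exec.LoopTrue[OF b 1(1) 2(1)] 2(3) show ?case unfolding tot_def by blast
qed

section \<open>Bounded loops\<close>

definition For :: "name \<Rightarrow> iexp \<Rightarrow> com \<Rightarrow> com" where
  "For x e P = Seq (SetReg x (IConst 0))
    (Loop (ILess (IReg x) e) (Seq P (SetReg x (IAdd (IReg x) (IConst 1)))))"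

lemma written_For [simp]:
  "written_regs (For x e P) = insert x (written_regs P)" "written_arrs (For x e P) = written_arrs P"
  by (auto simp: For_def)

fun read_regs :: "iexp \<Rightarrow> name set" where
  "read_regs (IConst c) = {}"
| "read_regs (IReg x) = {x}"
| "read_regs (IAdd a b) = read_regs a \<union> read_regs b"
| "read_regs (ISub a b) = read_regs a \<union> read_regs b"

lemma ival_frame: "frame W V s s' \<Longrightarrow> read_regs e \<inter> W = {} \<Longrightarrow> ival e s' = ival e s"
  by (induction e) (auto simp: frame_def Int_Un_distrib2)

text \<open>\<open>Inv\<close> must ignore the counter because the body establishes it before the
  increment. The 2 in each round is increment and test, the other 2 is initialisation and failing
  test.\<close>

lemma tot_For:
  assumes x: "x \<notin> written_regs P" and e: "read_regs e \<inter> insert x (written_regs P) = {}"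
    and N: "ival e s = N"
    and init: "Inv 0 s" and Inv: "\<And>j c s. Inv j (set_reg x c s) = Inv j s"
    and body: "\<And>j s1. j < N \<Longrightarrow> frame (insert x (written_regs P)) (written_arrs P) s s1 \<Longrightarrow>
      reg s1 x = j \<Longrightarrow> Inv j s1 \<Longrightarrow> tot P T (Inv (Suc j)) s1"
    and T: "N * (T + 2) + 2 \<le> T'"
    and post: "\<And>s'. frame (insert x (written_regs P)) (written_arrs P) s s' \<Longrightarrow> Inv N s' \<Longrightarrow> Q s'"
  shows "tot (For x e P) T' Q s"
proof -
  let ?F = "frame (insert x (written_regs P)) (written_arrs P) s"
  let ?I = "\<lambda>j s1. ?F s1 \<and> reg s1 x = j \<and> Inv j s1"
  let ?B = "Seq P (SetReg x (IAdd (IReg x) (IConst 1)))"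
  have "tot (Loop (ILess (IReg x) e) ?B) ((N - 0) * (T + 1 + 1) + 1) (?I N) (set_reg x 0 s)"
  proof (rule tot_Loop)
    show "?I 0 (set_reg x 0 s)" using init Inv by (auto simp: frame_def)
  next
    fix j s1 assume "?I j s1"
    then show "bval (ILess (IReg x) e) s1 \<longleftrightarrow> j < N"
      using ival_frame[of "insert x (written_regs P)" "written_arrs P" s s1 e] e N by simp
  next
    fix j s1 assume I: "?I j s1" and j: "j < N"
    have "tot P T (Inv (Suc j)) s1" using body[OF j] I by blast
    then have "tot P T (tot (SetReg x (IAdd (IReg x) (IConst 1))) 1 (?I (Suc j))) s1"
    proof (rule tot_frame)
      fix s2 assume f: "frame (written_regs P) (written_arrs P) s1 s2" and i: "Inv (Suc j) s2"
      have "frame (insert x (written_regs P)) (written_arrs P) s2 (set_reg x (Suc j) s2)"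
        by (auto simp: frame_def)
      moreover have "frame (insert x (written_regs P)) (written_arrs P) s1 s2"
        by (rule frame_mono[OF f]) auto
      ultimately have "?F (set_reg x (Suc j) s2)" using I by (blast intro: frame_trans)
      moreover have "reg s2 x = j" using frame_reg[OF f x] I by simp
      ultimately show "tot (SetReg x (IAdd (IReg x) (IConst 1))) 1 (?I (Suc j)) s2"
        using i Inv by (intro tot_SetReg) auto
    qed simp
    then show "tot ?B (T + 1) (?I (Suc j)) s1" by (rule tot_Seq) simp
  qed simp
  then have "tot (Loop (ILess (IReg x) e) ?B) (N * (T + 2) + 1) Q (set_reg x 0 s)"
    by (rule tot_mono) (use post in auto)
  then show ?thesis
    unfolding For_def using T by (intro tot_Seq[where T = 1, OF tot_SetReg]) auto
qed

definition SumTo :: "name \<Rightarrow> name \<Rightarrow> iexp \<Rightarrow> rexp \<Rightarrow> com" where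
  "SumTo v x e r = Seq (SetCell v (IConst 0) (IConst 0) (RCast (IConst 0)))
    (For x e (SetCell v (IConst 0) (IConst 0) (RAdd (RCell v (IConst 0) (IConst 0)) r)))"

lemma written_SumTo [simp]:
  "written_regs (SumTo v x e r) = {x}" "written_arrs (SumTo v x e r) = {v}"
  by (auto simp: SumTo_def)

text \<open>The summand is evaluated in stores that differ from \<open>s\<close> only in counter and
  accumulator, so \<open>f\<close> can be given in terms of \<open>s\<close> alone.\<close>

lemma tot_SumTo:
  assumes x: "x \<notin> read_regs e" and N: "ival e s = N"
    and r: "\<And>j s1. j < N \<Longrightarrow> frame {x} {v} s s1 \<Longrightarrow> reg s1 x = j \<Longrightarrow> rval r s1 = f j"
    and T: "3 * N + 3 \<le> T"
    and post: "\<And>s'. frame {x} {v} s s' \<Longrightarrow> arr s' v 0 0 = (\<Sum>j<N. f j) \<Longrightarrow> Q s'"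
  shows "tot (SumTo v x e r) T Q s"
  unfolding SumTo_def
proof (rule tot_Seq[where T = 1 and U = "3 * N + 2", OF tot_SetCell])
  let ?s = "set_cell v 0 0 0 s"
  have f0: "frame {x} {v} s ?s" by (simp add: frame_def)
  have "tot (For x e (SetCell v (IConst 0) (IConst 0) (RAdd (RCell v (IConst 0) (IConst 0)) r)))
      (3 * N + 2) Q ?s"
  proof (rule tot_For[where T = 1 and Inv = "\<lambda>j s1. arr s1 v 0 0 = (\<Sum>j<j. f j)"])
    show "ival e ?s = N" using ival_frame[OF f0, of e] x N by auto
  next
    fix j s1 assume a: "j < N" "reg s1 x = j" "arr s1 v 0 0 = (\<Sum>j<j. f j)"
      and f: "frame (insert x (written_regs (SetCell v (IConst 0) (IConst 0)
        (RAdd (RCell v (IConst 0) (IConst 0)) r)))) (written_arrs (SetCell v (IConst 0) (IConst 0)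
        (RAdd (RCell v (IConst 0) (IConst 0)) r))) ?s s1"
    have "frame {x} {v} s s1" using frame_trans[OF f0] f by simp
    then have "rval r s1 = f j" using r a by blast
    with a show "tot (SetCell v (IConst 0) (IConst 0) (RAdd (RCell v (IConst 0) (IConst 0)) r))
      1 (\<lambda>s1. arr s1 v 0 0 = (\<Sum>j<Suc j. f j)) s1"
      by (intro tot_SetCell) auto
  next
    fix s1 assume f: "frame (insert x (written_regs (SetCell v (IConst 0) (IConst 0)
        (RAdd (RCell v (IConst 0) (IConst 0)) r)))) (written_arrs (SetCell v (IConst 0) (IConst 0)
        (RAdd (RCell v (IConst 0) (IConst 0)) r))) ?s s1"
      and a: "arr s1 v 0 0 = (\<Sum>j<N. f j)"
    have "frame {x} {v} s s1" using frame_trans[OF f0] f by simp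
    then show "Q s1" using post a by blast
  qed (use x in auto)
  then show "tot (For x e (SetCell v (IConst 0) (IConst 0) (RAdd (RCell v (IConst 0) (IConst 0)) r)))
    (3 * N + 2) Q (set_cell v (ival (IConst 0) s) (ival (IConst 0) s) (rval (RCast (IConst 0)) s) s)"
    by simp
qed (use T in auto)

definition MapCol :: "name \<Rightarrow> name \<Rightarrow> iexp \<Rightarrow> iexp \<Rightarrow> rexp \<Rightarrow> com" where
  "MapCol v x e c r = For x e (SetCell v (IReg x) c r)"

lemma written_MapCol [simp]:
  "written_regs (MapCol v x e c r) = {x}" "written_arrs (MapCol v x e c r) = {v}"
  by (auto simp: MapCol_def)

text \<open>At index \<open>j\<close> only rows below \<open>j\<close> of column \<open>C\<close>
  have been overwritten. Hence \<open>r\<close> may read the old value at row \<open>j\<close> of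
  the same array, which makes the in-place updates of \<open>P\<close> and \<open>Y\<close>
  correct.\<close>

lemma tot_MapCol:
  assumes x: "x \<notin> read_regs e" "x \<notin> read_regs c" and N: "ival e s = N" and C: "ival c s = C"
    and r: "\<And>j s1. j < N \<Longrightarrow> frame {x} {v} s s1 \<Longrightarrow> reg s1 x = j \<Longrightarrow>
      (\<And>p q. p \<ge> j \<or> q \<noteq> C \<Longrightarrow> arr s1 v p q = arr s v p q) \<Longrightarrow> rval r s1 = f j"
    and T: "3 * N + 2 \<le> T"
    and post: "\<And>s'. frame {x} {v} s s' \<Longrightarrow>
      (\<And>p q. arr s' v p q = (if p < N \<and> q = C then f p else arr s v p q)) \<Longrightarrow> Q s'"
  shows "tot (MapCol v x e c r) T Q s"
  unfolding MapCol_def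
proof (rule tot_For[where T = 1 and
      Inv = "\<lambda>j s'. \<forall>p q. arr s' v p q = (if p < j \<and> q = C then f p else arr s v p q)"])
  fix j s1 assume a: "j < N" "reg s1 x = j"
    and i: "\<forall>p q. arr s1 v p q = (if p < j \<and> q = C then f p else arr s v p q)"
    and f: "frame (insert x (written_regs (SetCell v (IReg x) c r)))
      (written_arrs (SetCell v (IReg x) c r)) s s1"
  have f: "frame {x} {v} s s1" using f by simp
  have "rval r s1 = f j" by (rule r[OF a(1) f a(2)]) (use i in auto)
  moreover have "ival c s1 = C" using ival_frame[OF f, of c] x C by auto
  ultimately show "tot (SetCell v (IReg x) c r) 1
    (\<lambda>s'. \<forall>p q. arr s' v p q = (if p < Suc j \<and> q = C then f p else arr s v p q)) s1"
    using a i by (intro tot_SetCell) auto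
qed (use x N T post in auto)

section \<open>The pursuit program\<close>

abbreviation scalar :: "name \<Rightarrow> rexp" where
  "scalar v \<equiv> RCell v (IConst 0) (IConst 0)"

abbreviation set_scalar :: "name \<Rightarrow> rexp \<Rightarrow> com" where
  "set_scalar v r \<equiv> SetCell v (IConst 0) (IConst 0) r"

abbreviation residual :: "name \<Rightarrow> rexp" where
  "residual i \<equiv> RSub (RCell ''X'' (IReg ''a'') (IReg i)) (RCell ''P'' (IReg ''a'') (IReg i))"

abbreviation new_atom :: rexp where
  "new_atom \<equiv> RCell ''A'' (IReg ''a'') (IReg ''m_out'')"

abbreviation worthwhile :: bexp where
  "worthwhile \<equiv> RLess (RMul (RMul (scalar ''c'') (scalar ''zz'')) (RCell ''N'' (IReg ''i'') (IConst 0)))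
     (RMul (scalar ''zr'') (scalar ''zr''))"

definition compute_gain :: com where
  "compute_gain =
    Seq (SumTo ''zz'' ''a'' (IReg ''d'') (RMul (residual ''l'') (residual ''l'')))
    (Seq (set_scalar ''gain'' (RCast (IConst 0)))
    (For ''i'' (IReg ''n'')
      (Seq (SumTo ''zr'' ''a'' (IReg ''d'') (RMul (residual ''l'') (residual ''i'')))
      (Cond worthwhile
        (set_scalar ''gain''
          (RAdd (scalar ''gain'') (RDiv (RMul (scalar ''zr'') (scalar ''zr'')) (scalar ''zz''))))
        Skip))))"

definition select_best :: com where
  "select_best =
    Seq (set_scalar ''best'' (RCast (IConst 0)))
    (Seq (SetReg ''b'' (IConst 0))
    (For ''l'' (IReg ''n'')
      (Seq compute_gain
      (Cond (RLess (scalar ''best'') (scalar ''gain''))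
        (Seq (SetReg ''b'' (IReg ''l'')) (set_scalar ''best'' (scalar ''gain'')))
        Skip))))"

text \<open>After the first \<open>MapCol\<close>, \<open>P\<close> holds the vector
  \<open>q\<close> of \<open>column_inv_step\<close>, and \<open>t\<close> projects the column of
  \<open>X\<close> to its span. \<open>Y\<close> is scaled by the same factor so that
  \<open>P\<close> remains the product of \<open>A\<close> and \<open>Y\<close>.\<close>

definition update_column :: com where
  "update_column =
    Seq (SumTo ''zr'' ''a'' (IReg ''d'') (RMul new_atom (residual ''i'')))
    (Cond worthwhile
      (Seq (SetCell ''Y'' (IReg ''m_out'') (IReg ''i'') (RDiv (scalar ''zr'') (scalar ''zz'')))
      (Seq (MapCol ''P'' ''a'' (IReg ''d'') (IReg ''i'')
        (RAdd (RCell ''P'' (IReg ''a'') (IReg ''i''))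
          (RMul (RCell ''Y'' (IReg ''m_out'') (IReg ''i'')) new_atom)))
      (Seq (SumTo ''u'' ''a'' (IReg ''d'')
        (RMul (RCell ''X'' (IReg ''a'') (IReg ''i'')) (RCell ''P'' (IReg ''a'') (IReg ''i''))))
      (Seq (SumTo ''v'' ''a'' (IReg ''d'')
        (RMul (RCell ''P'' (IReg ''a'') (IReg ''i'')) (RCell ''P'' (IReg ''a'') (IReg ''i''))))
      (Seq (set_scalar ''t'' (RDiv (scalar ''u'') (scalar ''v'')))
      (Seq (MapCol ''P'' ''a'' (IReg ''d'') (IReg ''i'')
        (RMul (scalar ''t'') (RCell ''P'' (IReg ''a'') (IReg ''i''))))
      (MapCol ''Y'' ''h'' (IAdd (IReg ''m_out'') (IConst 1)) (IReg ''i'')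
        (RMul (scalar ''t'') (RCell ''Y'' (IReg ''h'') (IReg ''i''))))))))))
      Skip)"

definition add_atom :: com where
  "add_atom =
    Seq (MapCol ''A'' ''a'' (IReg ''d'') (IReg ''m_out'') (residual ''b''))
    (Seq (SumTo ''zz'' ''a'' (IReg ''d'') (RMul new_atom new_atom))
    (For ''i'' (IReg ''n'') update_column))"

definition pursuit_round :: com where
  "pursuit_round =
    Seq select_best (Seq add_atom (SetReg ''m_out'' (IAdd (IReg ''m_out'') (IConst 1))))"

lemma written_compute_gain [simp]:
  "written_regs compute_gain = {''a'', ''i''}"
  "written_arrs compute_gain = {''zz'', ''gain'', ''zr''}"
  by (auto simp: compute_gain_def)

lemma written_select_best [simp]:
  "written_regs select_best = {''a'', ''i'', ''l'', ''b''}"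
  "written_arrs select_best = {''zz'', ''gain'', ''zr'', ''best''}"
  by (auto simp: select_best_def)

lemma written_update_column [simp]:
  "written_regs update_column = {''a'', ''h''}"
  "written_arrs update_column = {''zr'', ''u'', ''v'', ''t'', ''P'', ''Y''}"
  by (auto simp: update_column_def)

lemma written_add_atom [simp]:
  "written_regs add_atom = {''a'', ''h'', ''i''}"
  "written_arrs add_atom = {''A'', ''zz'', ''zr'', ''u'', ''v'', ''t'', ''P'', ''Y''}"
  by (auto simp: add_atom_def)

text \<open>Leaves the whole remaining budget to \<open>Q\<close>, so that only the bound for
  \<open>P\<close> has to be supplied.\<close>

lemma tot_Seq': "tot P T (tot Q (V - T) R) s \<Longrightarrow> T \<le> V \<Longrightarrow> tot (Seq P Q) V R s"
  by (erule tot_Seq) simp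

section \<open>Correctness and cost of the parts of a round\<close>

abbreviation res :: "store \<Rightarrow> nat \<Rightarrow> nat \<Rightarrow> real" where
  "res s i \<equiv> \<lambda>a. arr s ''X'' a i - arr s ''P'' a i"

abbreviation store_gain :: "store \<Rightarrow> (nat \<Rightarrow> real) \<Rightarrow> real" where
  "store_gain s \<equiv> gain {..<reg s ''d''} {..<reg s ''n''} (arr s ''c'' 0 0) (\<lambda>i. arr s ''N'' i 0) (res s)"

lemma tot_compute_gain:
  assumes d: "reg s ''d'' = d" and n: "reg s ''n'' = n" and T: "n * (3 * d + 7) + 3 * d + 6 \<le> T"
    and post: "\<And>s'. frame {''a'', ''i''} {''zz'', ''gain'', ''zr''} s s' \<Longrightarrow>
      arr s' ''gain'' 0 0 = store_gain s (res s (reg s ''l'')) \<Longrightarrow> Q s'"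
  shows "tot compute_gain T Q s"
proof -
  let ?r = "res s" and ?l = "reg s ''l''"
  let ?zz = "dot {..<d} (?r ?l) (?r ?l)"
  define f where "f i = (if arr s ''c'' 0 0 * ?zz * arr s ''N'' i 0 < (dot {..<d} (?r ?l) (?r i))\<^sup>2
    then (dot {..<d} (?r ?l) (?r i))\<^sup>2 / ?zz else 0)" for i
  have "tot compute_gain (n * (3 * d + 7) + 3 * d + 6) (\<lambda>s'. arr s' ''gain'' 0 0 = (\<Sum>i<n. f i)) s"
    unfolding compute_gain_def
  proof (rule tot_Seq'[where T = "3 * d + 3"],
      rule tot_SumTo[where N = d and f = "\<lambda>a. ?r ?l a * ?r ?l a"], goal_cases)
    case (3 j s1)
    then show ?case by (simp add: frame_reg[OF 3(2)] frame_arr[OF 3(2)])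
  next
    case (5 s1)
    note f1s = frame_reg[OF 5(1)] frame_arr[OF 5(1)]
    have zz: "arr s1 ''zz'' 0 0 = ?zz" using 5(2) by (simp add: dot_def)
    show ?case
    proof (rule tot_Seq'[where T = 1], rule tot_SetCell,
        rule tot_For[where N = n and T = "3 * d + 5" and
          Inv = "\<lambda>j s'. arr s' ''gain'' 0 0 = (\<Sum>i<j. f i)"], goal_cases)
      case (6 j s3)
      note f3s = frame_reg[OF 6(2)] frame_arr[OF 6(2)]
      show ?case
      proof (rule tot_Seq'[where T = "3 * d + 3"],
          rule tot_SumTo[where N = d and f = "\<lambda>a. ?r ?l a * ?r j a"], goal_cases)
        case (3 a s4)
        then show ?case
          using 6 by (simp add: frame_reg[OF 3(2)] frame_arr[OF 3(2)] f3s f1s)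
      next
        case (5 s4)
        note f4s = frame_reg[OF 5(1)] frame_arr[OF 5(1)]
        have zr: "arr s4 ''zr'' 0 0 = dot {..<d} (?r ?l) (?r j)" using 5(2) by (simp add: dot_def)
        show ?case
          by (rule tot_Cond[where T = 1]; (rule tot_SetCell tot_Skip)?)
            (use 6 zr zz in \<open>simp_all add: f4s f3s f1s f_def power2_eq_square\<close>)
      qed (use 6 d in \<open>simp_all add: f3s f1s\<close>)
    qed (use n in \<open>simp_all add: f1s\<close>)
  qed (use d in simp_all)
  moreover have "(\<Sum>i<n. f i) = store_gain s (res s (reg s ''l''))"
    by (simp add: f_def gain_def d n)
  ultimately show ?thesis
    by (elim tot_frame) (use T post in auto)
qed

lemma tot_select_best:
  assumes d: "reg s ''d'' = d" and n: "reg s ''n'' = n"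
    and T: "n * (n * (3 * d + 7) + 3 * d + 11) + 4 \<le> T"
    and post: "\<And>s'. frame {''a'', ''i'', ''l'', ''b''} {''zz'', ''gain'', ''zr'', ''best''} s s' \<Longrightarrow>
      (\<And>l. l < n \<Longrightarrow> store_gain s (res s l) \<le> store_gain s (res s (reg s' ''b''))) \<Longrightarrow> Q s'"
  shows "tot select_best T Q s"
proof -
  define g where "g l = store_gain s (res s l)" for l
  have g0: "0 \<le> g l" for l by (simp add: g_def gain_nonneg)
  \<comment> \<open>\<open>best\<close> lies between all gains seen so far and the gain of the
    current choice \<open>b\<close>. The initial values qualify because no gain is negative.\<close>
  let ?I = "\<lambda>j s'. (\<forall>l<j. g l \<le> arr s' ''best'' 0 0) \<and> arr s' ''best'' 0 0 \<le> g (reg s' ''b'')"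
  let ?T = "n * (n * (3 * d + 7) + 3 * d + 11) + 4"
  have "tot select_best ?T (?I n) s"
    unfolding select_best_def
  proof (rule tot_Seq'[where T = 1], rule tot_SetCell, rule tot_Seq'[where T = 1], rule tot_SetReg,
      rule tot_For[where N = n and T = "n * (3 * d + 7) + 3 * d + 9" and Inv = ?I], goal_cases)
    case (6 j s1)
    note f1s = frame_reg[OF 6(2)] frame_arr[OF 6(2)]
    show ?case
    proof (rule tot_Seq'[where T = "n * (3 * d + 7) + 3 * d + 6"],
        rule tot_compute_gain[where d = d and n = n], goal_cases)
      case (4 s2)
      note f2s = frame_reg[OF 4(1)] frame_arr[OF 4(1)]
      have gain: "arr s2 ''gain'' 0 0 = g j" using 4(2) 6 by (simp add: f1s g_def)
      have "?I j s2" using 6 by (simp add: f2s)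
      with gain 6 show ?case
        by (intro tot_Cond[where T = 2] tot_Seq'[where T = 1] tot_SetCell tot_SetReg tot_Skip)
          (auto simp: f2s less_Suc_eq)
    qed (use d n in \<open>simp_all add: f1s\<close>)
  qed (use n g0 in \<open>simp_all add: algebra_simps\<close>)
  then show ?thesis
    by (rule tot_frame) (use T post in \<open>fastforce simp: g_def\<close>)+
qed

text \<open>If the test fails, the share of the column in the gain is 0 and
  \<open>column_inv_Suc\<close> applies; otherwise the assignments realise the hypotheses of
  \<open>column_inv_step\<close>.\<close>

lemma tot_update_column:
  assumes d: "reg s ''d'' = d" and M: "reg s ''m_out'' = M" and i: "reg s ''i'' = i"
    and c: "arr s ''c'' 0 0 = c" "0 \<le> c"
    and N: "arr s ''N'' i 0 = dot {..<d} (\<lambda>a. arr s ''X'' a i) (\<lambda>a. arr s ''X'' a i)"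
    and zz: "arr s ''zz'' 0 0 = dot {..<d} (\<lambda>a. arr s ''A'' a M) (\<lambda>a. arr s ''A'' a M)"
    and I: "column_inv d c (arr s ''A'') M
      (\<lambda>a. arr s ''X'' a i) (\<lambda>a. arr s ''P'' a i) (\<lambda>h. arr s ''Y'' h i)"
    and T: "15 * d + 3 * M + 21 \<le> T"
    and post: "\<And>s'. frame {''a'', ''h''} {''zr'', ''u'', ''v'', ''t'', ''P'', ''Y''} s s' \<Longrightarrow>
      (\<And>p q. q \<noteq> i \<Longrightarrow> arr s' ''P'' p q = arr s ''P'' p q \<and> arr s' ''Y'' p q = arr s ''Y'' p q) \<Longrightarrow>
      column_inv d c (arr s ''A'') (Suc M)
        (\<lambda>a. arr s ''X'' a i) (\<lambda>a. arr s' ''P'' a i) (\<lambda>h. arr s' ''Y'' h i) \<Longrightarrow>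
      dot {..<d} (res s' i) (res s' i) \<le> dot {..<d} (res s i) (res s i)
        - gain {..<d} {i} c (\<lambda>i. arr s ''N'' i 0) (res s) (\<lambda>a. arr s ''A'' a M) \<Longrightarrow> Q s'"
  shows "tot update_column T Q s"
proof -
  define zr where "zr = dot {..<d} (\<lambda>a. arr s ''A'' a M) (res s i)"
  define zz where "zz = dot {..<d} (\<lambda>a. arr s ''A'' a M) (\<lambda>a. arr s ''A'' a M)"
  define x where "x a = arr s ''X'' a i" for a
  define p where "p a = arr s ''P'' a i" for a
  define q where "q a = (if a < d then p a + zr / zz * arr s ''A'' a M else p a)" for a
  define t where "t = dot {..<d} x q / dot {..<d} q q"
  let ?Q = "\<lambda>s'. (\<forall>p q. q \<noteq> i \<longrightarrow> arr s' ''P'' p q = arr s ''P'' p q \<and> arr s' ''Y'' p q = arr s ''Y'' p q) \<and>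
      column_inv d c (arr s ''A'') (Suc M)
        (\<lambda>a. arr s ''X'' a i) (\<lambda>a. arr s' ''P'' a i) (\<lambda>h. arr s' ''Y'' h i) \<and>
      dot {..<d} (\<lambda>a. arr s ''X'' a i - arr s' ''P'' a i) (\<lambda>a. arr s ''X'' a i - arr s' ''P'' a i)
        \<le> dot {..<d} (res s i) (res s i)
        - gain {..<d} {i} c (\<lambda>i. arr s ''N'' i 0) (res s) (\<lambda>a. arr s ''A'' a M)"
  have "tot update_column (15 * d + 3 * M + 21) ?Q s"
    unfolding update_column_def
  proof (rule tot_Seq'[where T = "3 * d + 3"],
      rule tot_SumTo[where N = d and f = "\<lambda>a. arr s ''A'' a M * res s i a"], goal_cases)
    case (3 j s1)
    then show ?case using M i by (simp add: frame_reg[OF 3(2)] frame_arr[OF 3(2)])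
  next
    case (5 s1)
    note f1s = frame_reg[OF 5(1)] frame_arr[OF 5(1)]
    have zr1: "arr s1 ''zr'' 0 0 = zr" using 5(2) by (simp add: zr_def dot_def)
    have zz_s: "arr s ''zz'' 0 0 = zz" using zz by (simp add: zz_def)
    have test: "bval worthwhile s1 \<longleftrightarrow> c * zz * dot {..<d} x x < zr\<^sup>2"
      using c N i by (simp add: zr1 zz_s f1s x_def[abs_def] power2_eq_square)
    show ?case
    proof (rule tot_Cond[where T = "12 * d + 3 * M + 17"], goal_cases)
      case 2
      have "gain {..<d} {i} c (\<lambda>i. arr s ''N'' i 0) (res s) (\<lambda>a. arr s ''A'' a M) = 0"
        using 2 N unfolding test by (simp add: gain_def zr_def zz_def x_def[abs_def])
      then show ?case using column_inv_Suc[OF I] by (intro tot_Skip) (simp_all add: f1s)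
    next
      case 1
      then have test: "c * zz * dot {..<d} x x < zr\<^sup>2" unfolding test .
      have gain: "gain {..<d} {i} c (\<lambda>i. arr s ''N'' i 0) (res s) (\<lambda>a. arr s ''A'' a M) = zr\<^sup>2 / zz"
        using test N by (simp add: gain_def zr_def zz_def x_def[abs_def])
      show ?case
      proof (rule tot_Seq'[where T = 1], rule tot_SetCell, rule tot_Seq'[where T = "3 * d + 2"],
          rule tot_MapCol[where N = d and C = i and f = q], goal_cases)
        case (5 j s2)
        note f2s = frame_reg[OF 5(2)] frame_arr[OF 5(2)]
        show ?case using 5 M i
          by (simp add: f2s f1s q_def p_def zr1 zz_s)
      next
        case (7 s2)
        note f2s = frame_reg[OF 7(1)] frame_arr[OF 7(1)]
        note P2 = 7(2)
        show ?case
        proof (rule tot_Seq'[where T = "3 * d + 3"],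
            rule tot_SumTo[where N = d and f = "\<lambda>a. x a * q a"], goal_cases)
          case (3 j s3)
          then show ?case using 7 i
            by (simp add: frame_reg[OF 3(2)] frame_arr[OF 3(2)] f2s f1s x_def)
        next
          case (5 s3)
          note f3s = frame_reg[OF 5(1)] frame_arr[OF 5(1)]
          have u: "arr s3 ''u'' 0 0 = dot {..<d} x q" using 5 by (simp add: dot_def)
          show ?case
          proof (rule tot_Seq'[where T = "3 * d + 3"],
              rule tot_SumTo[where N = d and f = "\<lambda>a. q a * q a"], goal_cases)
            case (3 j s4)
            then show ?case using 7 i
              by (simp add: frame_reg[OF 3(2)] frame_arr[OF 3(2)] f3s f2s f1s)
          next
            case (5 s4)
            note f4s = frame_reg[OF 5(1)] frame_arr[OF 5(1)]
            have v: "arr s4 ''v'' 0 0 = dot {..<d} q q" using 5 by (simp add: dot_def)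
            show ?case
            proof (rule tot_Seq'[where T = 1], rule tot_SetCell, rule tot_Seq'[where T = "3 * d + 2"],
                rule tot_MapCol[where N = d and C = i and f = "\<lambda>a. t * q a"], goal_cases)
              case (5 j s5)
              then show ?case using 7 i u v
                by (simp add: frame_reg[OF 5(2)] frame_arr[OF 5(2)] f4s f3s f2s f1s t_def)
            next
              case (7 s5)
              note f5s = frame_reg[OF 7(1)] frame_arr[OF 7(1)]
              note P5 = 7(2)
              show ?case
              \<comment> \<open>\<open>m_out\<close> is still \<open>M\<close>, so the loop up to
                \<open>m_out + 1\<close> includes the entry just written in row
                \<open>M\<close>.\<close>
              proof (rule tot_MapCol[where N = "Suc M" and C = i and
                    f = "\<lambda>h. t * (if h = M then zr / zz else arr s ''Y'' h i)"], goal_cases)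
                case (5 j s6)
                have "arr s6 ''Y'' j i = (if j = M then zr / zz else arr s ''Y'' j i)"
                  using 5(4)[of j i] M i by (simp add: f5s f4s f3s f2s f1s zr1 zz_s)
                then show ?case using 5 P5[of 0 0] i
                  by (simp add: frame_reg[OF 5(2)] frame_arr[OF 5(2)] f5s f4s f3s f2s f1s t_def u v)
              next
                case (7 s6)
                note f6s = frame_reg[OF 7(1)] frame_arr[OF 7(1)]
                have Y: "arr s6 ''Y'' h i
                    = (if h < Suc M then t * ((\<lambda>h. arr s ''Y'' h i)(M := zr / zz)) h else arr s ''Y'' h i)" for h
                  using M i by (simp add: 7(2) f5s f4s f3s f2s f1s)
                have P: "arr s6 ''P'' a i = t * q a" if "a < d" for a
                  using that by (simp add: f6s P5)
                note step = column_inv_step[OF I c(2) zz_def zr_def,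
                    where q = q and t = t and p' = "\<lambda>a. arr s6 ''P'' a i" and y' = "\<lambda>h. arr s6 ''Y'' h i"]
                have "column_inv d c (arr s ''A'') (Suc M)
                    (\<lambda>a. arr s ''X'' a i) (\<lambda>a. arr s6 ''P'' a i) (\<lambda>h. arr s6 ''Y'' h i)"
                  by (rule step(1))
                    (use test P Y in \<open>auto simp: q_def p_def t_def x_def[abs_def]\<close>)
                moreover have "dot {..<d} (\<lambda>a. arr s ''X'' a i - arr s6 ''P'' a i)
                    (\<lambda>a. arr s ''X'' a i - arr s6 ''P'' a i) \<le> dot {..<d} (res s i) (res s i) - zr\<^sup>2 / zz"
                  by (rule step(2))
                    (use test P Y in \<open>auto simp: q_def p_def t_def x_def[abs_def]\<close>)
                moreover have "arr s6 ''P'' p q' = arr s ''P'' p q' \<and> arr s6 ''Y'' p q' = arr s ''Y'' p q'"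
                  if "q' \<noteq> i" for p q'
                  using that M i by (simp add: 7(2) f6s P5 f4s f3s P2 f5s f2s f1s)
                ultimately show ?case unfolding gain by simp
              qed (use M i in \<open>simp_all add: f5s f4s f3s f2s f1s\<close>)
            qed (use d i in \<open>simp_all add: f4s f3s f2s f1s\<close>)
          qed (use d in \<open>simp_all add: f3s f2s f1s\<close>)
        qed (use d in \<open>simp_all add: f2s f1s\<close>)
      qed (use d i in \<open>simp_all add: f1s\<close>)
    qed simp
  qed (use d in simp_all)
  then show ?thesis
  proof (rule tot_frame)
    fix s' assume f: "frame (written_regs update_column) (written_arrs update_column) s s'" and "?Q s'"
    then show "Q s'"
      using post[of s'] by (simp add: frame_arr[OF f])
  qed (use T in simp)
qed

text \<open>The residual of column \<open>b\<close> is copied into \<open>A\<close> before any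
  column changes, and updating one column leaves the others alone. So each column meets the residual
  it had in \<open>s\<close>, and the individual decreases add up to the gain computed
  there.\<close>

lemma tot_add_atom:
  assumes d: "reg s ''d'' = d" and n: "reg s ''n'' = n" and M: "reg s ''m_out'' = M"
    and c: "arr s ''c'' 0 0 = c" "0 \<le> c"
    and N: "\<And>i. i < n \<Longrightarrow>
      arr s ''N'' i 0 = dot {..<d} (\<lambda>a. arr s ''X'' a i) (\<lambda>a. arr s ''X'' a i)"
    and I: "\<And>i. i < n \<Longrightarrow> column_inv d c (arr s ''A'') M
      (\<lambda>a. arr s ''X'' a i) (\<lambda>a. arr s ''P'' a i) (\<lambda>h. arr s ''Y'' h i)"
    and T: "n * (15 * d + 3 * M + 23) + 6 * d + 7 \<le> T"
    and post: "\<And>s'. frame {''a'', ''h'', ''i''} {''A'', ''zz'', ''zr'', ''u'', ''v'', ''t'', ''P'', ''Y''} s s' \<Longrightarrow>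
      (\<And>i. i < n \<Longrightarrow> column_inv d c (arr s' ''A'') (Suc M)
        (\<lambda>a. arr s ''X'' a i) (\<lambda>a. arr s' ''P'' a i) (\<lambda>h. arr s' ''Y'' h i)) \<Longrightarrow>
      (\<Sum>i<n. dot {..<d} (res s' i) (res s' i))
        \<le> (\<Sum>i<n. dot {..<d} (res s i) (res s i)) - store_gain s (res s (reg s ''b'')) \<Longrightarrow> Q s'"
  shows "tot add_atom T Q s"
proof -
  let ?b = "reg s ''b''"
  let ?gain = "\<lambda>i. gain {..<d} {i} c (\<lambda>i. arr s ''N'' i 0) (res s) (res s ?b)"
  let ?E = "\<lambda>s' i. dot {..<d} (\<lambda>a. arr s ''X'' a i - arr s' ''P'' a i) (\<lambda>a. arr s ''X'' a i - arr s' ''P'' a i)"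
  let ?I = "\<lambda>j s'. (\<forall>i<j. column_inv d c (arr s' ''A'') (Suc M)
        (\<lambda>a. arr s ''X'' a i) (\<lambda>a. arr s' ''P'' a i) (\<lambda>h. arr s' ''Y'' h i) \<and>
        ?E s' i \<le> ?E s i - ?gain i) \<and>
      (\<forall>i. j \<le> i \<longrightarrow> (\<forall>a. arr s' ''P'' a i = arr s ''P'' a i \<and> arr s' ''Y'' a i = arr s ''Y'' a i))"
  have "tot add_atom (n * (15 * d + 3 * M + 23) + 6 * d + 7) (?I n) s"
    unfolding add_atom_def
  proof (rule tot_Seq'[where T = "3 * d + 2"],
      rule tot_MapCol[where N = d and C = M and f = "res s ?b"], goal_cases)
    case (5 j s1)
    then show ?case by (simp add: frame_reg[OF 5(2)] frame_arr[OF 5(2)])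
  next
    case (7 s1)
    note f1s = frame_reg[OF 7(1)] frame_arr[OF 7(1)]
    note A = 7(2)
    show ?case
    proof (rule tot_Seq'[where T = "3 * d + 3"],
        rule tot_SumTo[where N = d and f = "\<lambda>a. arr s1 ''A'' a M * arr s1 ''A'' a M"], goal_cases)
      case (3 j s2)
      then show ?case using M by (simp add: frame_reg[OF 3(2)] frame_arr[OF 3(2)] f1s)
    next
      case (5 s2)
      note f2s = frame_reg[OF 5(1)] frame_arr[OF 5(1)]
      have zz: "arr s2 ''zz'' 0 0 = dot {..<d} (\<lambda>a. arr s1 ''A'' a M) (\<lambda>a. arr s1 ''A'' a M)"
        using 5(2) by (simp add: dot_def)
      show ?case
      proof (rule tot_For[where N = n and T = "15 * d + 3 * M + 21" and Inv = ?I], goal_cases)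
        case (6 j s3)
        note f3s = frame_reg[OF 6(2)] frame_arr[OF 6(2)]
        have old: "arr s3 ''P'' a j = arr s ''P'' a j" "arr s3 ''Y'' a j = arr s ''Y'' a j" for a
          using 6(4) by auto
        have gain: "gain {..<d} {j} c (\<lambda>i. arr s3 ''N'' i 0) (res s3) (\<lambda>a. arr s3 ''A'' a M) = ?gain j"
        proof -
          have "gain {..<d} {j} c (\<lambda>i. arr s3 ''N'' i 0) (res s3) (\<lambda>a. arr s3 ''A'' a M)
              = gain {..<d} {j} c (\<lambda>i. arr s ''N'' i 0) (res s3) (res s ?b)"
            by (rule gain_cong) (simp_all add: f3s f2s f1s A)
          also have "\<dots> = ?gain j" by (simp add: gain_def old f3s f2s f1s)
          finally show ?thesis .
        qed
        show ?case
        proof (rule tot_update_column[where d = d and M = M and i = j and c = c], goal_cases)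
          case 8
          have "column_inv d c (arr s3 ''A'') M
              (\<lambda>a. arr s ''X'' a j) (\<lambda>a. arr s ''P'' a j) (\<lambda>h. arr s ''Y'' h j)"
            by (rule column_inv_cong[OF I[OF 6(1)]]) (simp add: f3s f2s A)
          then show ?case by (simp add: old f3s f2s f1s)
        next
          case (10 s4)
          note f4s = frame_reg[OF 10(1)] frame_arr[OF 10(1)]
          have "?E s4 j \<le> ?E s j - ?gain j"
            using 10(4) unfolding gain by (simp add: f4s f3s f2s f1s old)
          moreover have "column_inv d c (arr s4 ''A'') (Suc M)
              (\<lambda>a. arr s ''X'' a j) (\<lambda>a. arr s4 ''P'' a j) (\<lambda>h. arr s4 ''Y'' h j)"
            using 10(3) by (simp add: f4s f3s f2s f1s)
          moreover have "arr s4 ''P'' p q = arr s3 ''P'' p q" "arr s4 ''Y'' p q = arr s3 ''Y'' p q"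
            if "q \<noteq> j" for p q using 10(2)[OF that] by auto
          ultimately show ?case using 6(4) by (auto simp: less_Suc_eq f4s)
        qed (use 6 d n M c N zz in \<open>simp_all add: f3s f2s f1s\<close>)
      qed (use n in \<open>simp_all add: f2s f1s\<close>)
    qed (use d in \<open>simp_all add: f1s\<close>)
  qed (use d M in simp_all)
  then show ?thesis
  proof (rule tot_frame)
    fix s' assume f: "frame (written_regs add_atom) (written_arrs add_atom) s s'" and I: "?I n s'"
    have "(\<Sum>i<n. ?E s' i) \<le> (\<Sum>i<n. ?E s i - ?gain i)" using I by (intro sum_mono) auto
    also have "\<dots> = (\<Sum>i<n. ?E s i) - store_gain s (res s ?b)"
      unfolding d n c by (subst gain_eq_sum_singletons) (simp add: sum_subtractf)
    finally show "Q s'"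
      using post[of s'] I f by (simp add: frame_arr[OF f])
  qed (use T in simp)
qed

section \<open>The state between rounds\<close>

definition pursuit_state ::
    "nat \<Rightarrow> nat \<Rightarrow> real \<Rightarrow> real \<Rightarrow> (nat \<Rightarrow> nat \<Rightarrow> real) \<Rightarrow> nat \<Rightarrow> store \<Rightarrow> bool" where
  "pursuit_state d n c \<tau> X M s \<longleftrightarrow>
    reg s ''d'' = d \<and> reg s ''n'' = n \<and> reg s ''m_out'' = M \<and>
    arr s ''c'' 0 0 = c \<and> arr s ''tau'' 0 0 = \<tau> \<and> arr s ''X'' = X \<and>
    (\<forall>i<n. arr s ''N'' i 0 = dot {..<d} (\<lambda>a. X a i) (\<lambda>a. X a i)) \<and>
    (\<forall>i<n. column_inv d c (arr s ''A'') M (\<lambda>a. X a i) (\<lambda>a. arr s ''P'' a i) (\<lambda>h. arr s ''Y'' h i))"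

abbreviation sq_error :: "nat \<Rightarrow> nat \<Rightarrow> store \<Rightarrow> real" where
  "sq_error d n s \<equiv> \<Sum>i<n. dot {..<d} (res s i) (res s i)"

text \<open>The choice of \<open>b\<close> is hidden behind an upper bound \<open>g\<close> of all
  gains, which is the form that \<open>gain_lower_bound\<close> expects. A round without any gain
  still appends a column, so \<open>m_out\<close> counts the rounds.\<close>

lemma tot_pursuit_round:
  assumes I: "pursuit_state d n c \<tau> X M s" and c: "0 \<le> c"
    and T: "n * (n * (3 * d + 7) + 3 * d + 11) + n * (15 * d + 3 * M + 23) + 6 * d + 12 \<le> T"
    and post: "\<And>s' g. pursuit_state d n c \<tau> X (Suc M) s' \<Longrightarrow> 0 \<le> g \<Longrightarrow>
      (\<And>l. l < n \<Longrightarrow> gain {..<d} {..<n} c (\<lambda>i. dot {..<d} (\<lambda>a. X a i) (\<lambda>a. X a i)) (res s) (res s l) \<le> g) \<Longrightarrow>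
      sq_error d n s' \<le> sq_error d n s - g \<Longrightarrow> Q s'"
  shows "tot pursuit_round T Q s"
  unfolding pursuit_round_def
proof (rule tot_Seq'[where T = "n * (n * (3 * d + 7) + 3 * d + 11) + 4"],
    rule tot_select_best[where d = d and n = n], goal_cases)
  case (4 s1)
  note f1s = frame_reg[OF 4(1)] frame_arr[OF 4(1)]
  note best = 4(2)
  note I = I[unfolded pursuit_state_def]
  show ?case
  proof (rule tot_Seq'[where T = "n * (15 * d + 3 * M + 23) + 6 * d + 7"],
      rule tot_add_atom[where d = d and n = n and M = M and c = c], goal_cases)
    case (9 s2)
    note f2s = frame_reg[OF 9(1)] frame_arr[OF 9(1)]
    let ?g = "gain {..<d} {..<n} c (\<lambda>i. arr s ''N'' i 0) (res s) (res s (reg s1 ''b''))"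
    show ?case
    proof (rule tot_SetReg, rule post[where g = ?g], goal_cases)
      case 1
      then show ?case using I 9(2) by (auto simp: pursuit_state_def f2s f1s)
    next
      case (3 l)
      have "gain {..<d} {..<n} c (\<lambda>i. dot {..<d} (\<lambda>a. X a i) (\<lambda>a. X a i)) (res s) (res s l)
          = gain {..<d} {..<n} c (\<lambda>i. arr s ''N'' i 0) (res s) (res s l)"
        by (rule gain_cong) (use I in auto)
      then show ?case using best[OF 3] I by simp
    next
      case 4
      then show ?case using 9(3) I by (simp add: f1s)
    qed (use T in \<open>simp_all add: gain_nonneg\<close>)
  qed (use I T c in \<open>simp_all add: f1s\<close>)
qed (use I T in \<open>simp_all add: pursuit_state_def\<close>)

section \<open>Initialisation and the whole program\<close>

definition pursuit_setup :: com where
  "pursuit_setup =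
    Seq (For ''i'' (IReg ''n'')
      (Seq (SumTo ''u'' ''a'' (IReg ''d'')
        (RMul (RCell ''X'' (IReg ''a'') (IReg ''i'')) (RCell ''X'' (IReg ''a'') (IReg ''i''))))
      (SetCell ''N'' (IReg ''i'') (IConst 0) (scalar ''u''))))
    (Seq (set_scalar ''c'' (RDiv
      (RMul (RMul (scalar ''epsilon'') (scalar ''epsilon'')) (RMul (scalar ''epsilon'') (scalar ''epsilon'')))
      (RMul (RMul (RCast (IConst 1024)) (RMul (RCast (IReg ''k'')) (RCast (IReg ''k''))))
        (RMul (scalar ''Lambda'') (scalar ''Lambda'')))))
    (set_scalar ''tau'' (RDiv
      (RMul (RMul (RCast (IConst 1024)) (RMul (RCast (IReg ''m'')) (RMul (RCast (IReg ''k'')) (RCast (IReg ''k'')))))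
        (RMul (scalar ''Lambda'') (RMul (scalar ''Lambda'') (scalar ''Lambda''))))
      (RMul (RMul (RMul (scalar ''epsilon'') (scalar ''epsilon'')) (RMul (scalar ''epsilon'') (scalar ''epsilon'')))
        (scalar ''epsilon'')))))"

text \<open>The target error cannot be tested because \<open>\<gamma>\<close> is not among the
  inputs; the loop always runs until \<open>m_out\<close> reaches \<open>tau\<close>. Comparing the
  cast counter with the real number \<open>tau\<close> replaces rounding.\<close>

definition pursuit :: com where
  "pursuit = Seq pursuit_setup (Loop (RLess (RCast (IReg ''m_out'')) (scalar ''tau'')) pursuit_round)"

definition entries :: "real mat \<Rightarrow> nat \<Rightarrow> nat \<Rightarrow> real" where
  "entries X i j = (if i < dim_row X \<and> j < dim_col X then X $$ (i, j) else 0)"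

text \<open>All other arrays and \<open>m_out\<close> start at zero, which already represents the
  empty approximation of \<open>column_inv_init\<close>.\<close>

lemma tot_pursuit_setup:
  assumes X: "X \<in> carrier_mat d n"
    and post: "\<And>s'. pursuit_state d n (\<epsilon> ^ 4 / (1024 * real k ^ 2 * \<Lambda> ^ 2))
      (1024 * (real m * real k ^ 2 * \<Lambda> ^ 3 / \<epsilon> ^ 5)) (entries X) 0 s' \<Longrightarrow>
      arr s' ''P'' = (\<lambda>_ _. 0) \<Longrightarrow> Q s'"
    and T: "n * (3 * d + 6) + 4 \<le> T"
  shows "tot pursuit_setup T Q (input_store X m k \<Lambda> \<epsilon>)"
  unfolding pursuit_setup_def
proof (rule tot_Seq'[where T = "n * (3 * d + 6) + 2"],
    rule tot_For[where N = n and T = "3 * d + 4" and Inv = "\<lambda>j s'. \<forall>i<j. arr s' ''N'' i 0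
      = dot {..<d} (\<lambda>a. entries X a i) (\<lambda>a. entries X a i)"], goal_cases)
  case (6 j s1)
  note f1s = frame_reg[OF 6(2)] frame_arr[OF 6(2)]
  show ?case
  proof (rule tot_Seq'[where T = "3 * d + 3"],
      rule tot_SumTo[where N = d and f = "\<lambda>a. entries X a j * entries X a j"], goal_cases)
    case (3 a s2)
    then show ?case using 6 X
      by (simp add: frame_reg[OF 3(2)] frame_arr[OF 3(2)] f1s input_store_def entries_def)
  next
    case (5 s2)
    then show ?case using 6
      by (intro tot_SetCell) (auto simp: frame_reg[OF 5(1)] frame_arr[OF 5(1)] less_Suc_eq dot_def)
  qed (use X in \<open>simp_all add: f1s input_store_def\<close>)
next
  case (8 s1)
  note f1s = frame_reg[OF 8(1)] frame_arr[OF 8(1)]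
  have XX: "arr (input_store X m k \<Lambda> \<epsilon>) ''X'' = entries X"
    by (simp add: input_store_def entries_def fun_eq_iff)
  have other: "arr (input_store X m k \<Lambda> \<epsilon>) v = (\<lambda>_ _. 0)" if "v \<notin> {''X'', ''Lambda'', ''epsilon''}" for v
    using that by (simp add: input_store_def)
  have scal: "arr (input_store X m k \<Lambda> \<epsilon>) ''Lambda'' 0 0 = \<Lambda>"
    "arr (input_store X m k \<Lambda> \<epsilon>) ''epsilon'' 0 0 = \<epsilon>"
    by (simp_all add: input_store_def)
  have regs: "reg (input_store X m k \<Lambda> \<epsilon>) ''d'' = d" "reg (input_store X m k \<Lambda> \<epsilon>) ''n'' = n"
    "reg (input_store X m k \<Lambda> \<epsilon>) ''m'' = m" "reg (input_store X m k \<Lambda> \<epsilon>) ''k'' = k"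
    "reg (input_store X m k \<Lambda> \<epsilon>) ''m_out'' = 0"
    using X by (simp_all add: input_store_def)
  show ?case
    by (rule tot_Seq'[where T = 1], rule tot_SetCell, rule tot_SetCell, rule post)
      (use T 8(2) in \<open>simp_all add: f1s XX other scal regs pursuit_state_def column_inv_init
        power2_eq_square power3_eq_cube power4_eq_xxxx eval_nat_numeral mult_ac\<close>)
qed (use X T in \<open>simp_all add: input_store_def\<close>)

section \<open>Matrix norms and sparsity expressed by columns\<close>

lemma fnorm_sq: "(fnorm M)\<^sup>2 = (\<Sum>j<dim_col M. \<Sum>i<dim_row M. (M $$ (i, j))\<^sup>2)"
  unfolding fnorm_def by (subst sum.swap) (simp add: sum_nonneg)

lemma enorm_sq_col:
  assumes "M \<in> carrier_mat d n" "j < n"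
  shows "(enorm (col M j))\<^sup>2 = (\<Sum>i<d. (M $$ (i, j))\<^sup>2)"
  using assms by (simp add: enorm_def sum_nonneg)

lemma index_mult_mat_sum:
  fixes A B :: "real mat"
  assumes "A \<in> carrier_mat d m" "B \<in> carrier_mat m n" "i < d" "j < n"
  shows "(A * B) $$ (i, j) = (\<Sum>h<m. B $$ (h, j) * A $$ (i, h))"
  using assms by (simp add: scalar_prod_def atLeast0LessThan mult.commute)

lemma fnorm_diff_mult_sq:
  fixes A B :: "real mat"
  assumes "X \<in> carrier_mat d n" "A \<in> carrier_mat d m" "B \<in> carrier_mat m n"
  shows "(fnorm (X - A * B))\<^sup>2 =
    (\<Sum>j<n. \<Sum>i<d. (X $$ (i, j) - (\<Sum>h<m. B $$ (h, j) * A $$ (i, h)))\<^sup>2)"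
proof -
  have "(X - A * B) $$ (i, j) = X $$ (i, j) - (\<Sum>h<m. B $$ (h, j) * A $$ (i, h))"
    if "i < d" "j < n" for i j
    using assms that index_mult_mat_sum[OF assms(2,3) that] by (simp del: index_mult_mat(1))
  then show ?thesis using assms by (simp add: fnorm_sq del: index_mult_mat(1))
qed

lemma nnz_col:
  assumes "M \<in> carrier_mat d n" "j < n"
  shows "nnz (col M j) = card {i. i < d \<and> M $$ (i, j) \<noteq> 0}"
proof -
  have "{i. i < dim_vec (col M j) \<and> col M j $ i \<noteq> 0} = {i. i < d \<and> M $$ (i, j) \<noteq> 0}"
    using assms by auto
  then show ?thesis by (simp add: nnz_def)
qed

text \<open>Until the target error is reached, every round removes at least
  \<open>\<delta> = \<epsilon>\<^sup>4 F / (1024 \<Lambda>\<^sup>2 m k)\<close>, so \<open>\<tau>\<close> rounds remove \<open>\<tau> \<delta> = (k \<Lambda> / \<epsilon>) F\<close>, which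
  by \<open>excess_le\<close> is all that can be missing.\<close>

lemma tot_pursuit:
  fixes X As Ys :: "real mat" and \<Lambda> \<gamma> \<epsilon> :: real
  assumes X: "X \<in> carrier_mat d n" and pos: "m > 0" "k > 0" "\<Lambda> > 0" "\<epsilon> > 0"
    and As: "As \<in> carrier_mat d m" and Ys: "Ys \<in> carrier_mat m n"
    and unit: "\<forall>j<m. enorm (col As j) = 1"
    and sp: "\<forall>i<n. sparse k (col Ys i) \<and> (enorm (col Ys i))\<^sup>2 \<le> \<Lambda> * (enorm (col X i))\<^sup>2"
    and err: "(fnorm (X - As * Ys))\<^sup>2 \<le> \<gamma> * (fnorm X)\<^sup>2"
    and c: "c = \<epsilon> ^ 4 / (1024 * real k ^ 2 * \<Lambda> ^ 2)"
    and \<tau>: "\<tau> = 1024 * (real m * real k ^ 2 * \<Lambda> ^ 3 / \<epsilon> ^ 5)" and K: "K = nat \<lceil>\<tau>\<rceil>"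
  shows "tot pursuit
    (K * (n * (n * (3 * d + 7) + 3 * d + 11) + n * (15 * d + 3 * K + 23) + 6 * d + 13)
      + n * (3 * d + 6) + 5)
    (\<lambda>s. pursuit_state d n c \<tau> (entries X) K s \<and> sq_error d n s \<le> (\<gamma> + \<epsilon>) * (fnorm X)\<^sup>2)
    (input_store X m k \<Lambda> \<epsilon>)"
proof -
  define x where "x i a = entries X a i" for i a
  define a where "a j b = As $$ (b, j)" for j b
  define y where "y i j = Ys $$ (j, i)" for i j
  define N where "N i = dot {..<d} (x i) (x i)" for i
  define F where "F = (\<Sum>i<n. N i)"
  define \<delta> where "\<delta> = \<epsilon> ^ 4 * F / (1024 * \<Lambda> ^ 2 * m * k)"
  have x_eq: "x i b = X $$ (b, i)" if "b < d" "i < n" for i b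
    using X that by (simp add: x_def entries_def)
  have F: "(fnorm X)\<^sup>2 = F"
    unfolding fnorm_sq using X by (simp add: F_def N_def dot_def x_eq power2_eq_square)
  have a1: "dot {..<d} (a j) (a j) = 1" if "j \<in> {..<m}" for j
    using unit[rule_format, of j] that enorm_sq_col[OF As, of j] by (simp add: a_def dot_def power2_eq_square)
  have y_sp: "card {j \<in> {..<m}. y i j \<noteq> 0} \<le> k" if "i \<in> {..<n}" for i
    using sp[rule_format, of i] that nnz_col[OF Ys, of i] by (simp add: y_def sparse_def)
  have y_N: "(\<Sum>j<m. (y i j)\<^sup>2) \<le> \<Lambda> * N i" if "i \<in> {..<n}" for i
    using sp[rule_format, of i] that enorm_sq_col[OF Ys, of i] enorm_sq_col[OF X, of i]
    by (simp add: y_def N_def dot_def x_eq power2_eq_square)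
  have e: "(\<Sum>i<n. dot {..<d} (\<lambda>b. x i b - (\<Sum>j<m. y i j * a j b))
      (\<lambda>b. x i b - (\<Sum>j<m. y i j * a j b))) \<le> \<gamma> * F"
    using err unfolding F fnorm_diff_mult_sq[OF X As Ys]
    by (simp add: dot_def x_eq y_def a_def power2_eq_square)
  have F0: "0 \<le> F" by (simp add: F_def N_def sum_nonneg)
  have c0: "0 \<le> c" by (simp add: c)
  let ?goal = "\<lambda>s. sq_error d n s \<le> (\<gamma> + \<epsilon>) * F"
  \<comment> \<open>The disjunction is needed because a decrease by \<open>\<delta>\<close> is
    guaranteed only while the target is missed.\<close>
  let ?I = "\<lambda>j s. pursuit_state d n c \<tau> (entries X) j s \<and>
    (?goal s \<or> sq_error d n s \<le> F - j * \<delta>)"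
  let ?R = "n * (n * (3 * d + 7) + 3 * d + 11) + n * (15 * d + 3 * K + 23) + 6 * d + 12"
  have final: "?goal s" if "?I K s" for s
  proof (cases "?goal s")
    case False
    then have "sq_error d n s \<le> F - K * \<delta>" using that by blast
    moreover have "\<tau> * \<delta> \<le> K * \<delta>"
      using pos F0 K by (intro mult_right_mono) (simp_all add: \<delta>_def real_nat_ceiling_ge)
    moreover have "\<tau> * \<delta> = k * \<Lambda> / \<epsilon> * F"
      using pos by (simp add: \<tau> \<delta>_def field_simps eval_nat_numeral)
    moreover have "F - k * \<Lambda> / \<epsilon> * F \<le> (\<gamma> + \<epsilon>) * F"
      by (rule excess_le[where J = "{..<m}" and I = "{..<n}" and D = "{..<d}" and N = N and x = x
            and a = a and y = y]) (use pos a1 y_sp y_N e N_def F_def in auto)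
    ultimately show ?thesis by linarith
  qed
  have round: "tot pursuit_round ?R (?I (Suc j)) s" if I: "?I j s" and j: "j < K" for j s
  proof (rule tot_pursuit_round[where M = j and d = d and n = n and c = c and \<tau> = \<tau> and X = "entries X"],
      goal_cases)
    case 3
    have "15 * d + 3 * j + 23 \<le> 15 * d + 3 * K + 23" using j by simp
    then have "n * (15 * d + 3 * j + 23) \<le> n * (15 * d + 3 * K + 23)" by (rule mult_le_mono2)
    then show ?case by linarith
  next
    case (4 s' g)
    have S: "arr s ''X'' = entries X" and col: "\<And>i. i < n \<Longrightarrow> column_inv d c (arr s ''A'') j
        (x i) (\<lambda>a. arr s ''P'' a i) (\<lambda>h. arr s ''Y'' h i)"
      using I by (auto simp: pursuit_state_def x_def[abs_def])
    have res: "res s i = (\<lambda>a. x i a - arr s ''P'' a i)" for i by (simp add: S x_def)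
    \<comment> \<open>While the target is missed, \<open>gain_lower_bound\<close> yields
      \<open>\<delta> \<le> g\<close>. Once it is reached, \<open>0 \<le> g\<close> preserves
      it.\<close>
    have "?goal s' \<or> sq_error d n s' \<le> F - Suc j * \<delta>"
    proof (cases "?goal s")
      case False
      then have "sq_error d n s \<le> F - j * \<delta>" using I by blast
      moreover have "\<epsilon> ^ 4 * F \<le> 1024 * \<Lambda> ^ 2 * card {..<m} * k * g"
        by (rule gain_lower_bound[where I = "{..<n}" and D = "{..<d}" and N = N and x = x
              and a = a and y = y and r = "res s" and c = c and \<gamma> = \<gamma>])
          (use pos a1 y_sp y_N e N_def F_def False c 4(2,3) column_inv_orth[OF col]
            in \<open>auto simp: res x_def[abs_def] N_def[abs_def]\<close>)
      then have "\<delta> \<le> g" using pos by (simp add: \<delta>_def field_simps)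
      ultimately show ?thesis using 4(4) by (simp add: algebra_simps)
    qed (use 4(2,4) in linarith)
    then show ?case using 4(1) by simp
  qed (use I c0 in simp_all)
  have loop: "tot (Loop (RLess (RCast (IReg ''m_out'')) (scalar ''tau'')) pursuit_round)
      ((K - 0) * (?R + 1) + 1) (?I K) s"
    if s: "pursuit_state d n c \<tau> (entries X) 0 s" and P: "arr s ''P'' = (\<lambda>_ _. 0)" for s
  proof (rule tot_Loop[where Inv = ?I])
    have "sq_error d n s = F"
      using s P by (simp add: F_def N_def x_def[abs_def] pursuit_state_def)
    then show "?I 0 s" using s by simp
  next
    fix j s assume "?I j s" "j \<le> K"
    \<comment> \<open>A natural number is below \<open>\<tau>\<close> exactly if it is below the
      ceiling of \<open>\<tau>\<close>, so the loop makes exactly \<open>K\<close> rounds.\<close>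
    then show "bval (RLess (RCast (IReg ''m_out'')) (scalar ''tau'')) s \<longleftrightarrow> j < K"
      by (auto simp: pursuit_state_def K) linarith+
  qed (use round in auto)
  have "tot pursuit (K * (?R + 1) + 1 + (n * (3 * d + 6) + 4)) (?I K) (input_store X m k \<Lambda> \<epsilon>)"
    unfolding pursuit_def
    by (rule tot_Seq'[where T = "n * (3 * d + 6) + 4"], rule tot_pursuit_setup[OF X])
      (use loop in \<open>simp_all add: c \<tau>\<close>)
  then show ?thesis
    by (rule tot_mono) (use final F in auto)
qed

text \<open>The time is at most quartic in \<open>W\<close>, which collects \<open>d\<close>,
  \<open>n\<close> and \<open>K\<close>. Up to constants \<open>K\<close> is a product of 1 + 2 + 3
  + 5 = 11 factors bounded by \<open>B\<close>, whence the exponent 44. The constants 100 and 1027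
  absorb the terms of lower order.\<close>

lemma pursuit_time_bound:
  fixes d n m k :: nat and \<Lambda> \<epsilon> :: real
  assumes pos: "\<Lambda> > 0" "\<epsilon> > 0"
    and K: "K = nat \<lceil>1024 * (real m * real k ^ 2 * \<Lambda> ^ 3 / \<epsilon> ^ 5)\<rceil>"
  shows "real (K * (n * (n * (3 * d + 7) + 3 * d + 11) + n * (15 * d + 3 * K + 23) + 6 * d + 13)
      + n * (3 * d + 6) + 5)
    \<le> 100 * 1027 ^ 4 * (1 + real d + real n + real m + real k + \<Lambda> + 1 / \<epsilon>) ^ 44"
proof -
  define B where "B = 1 + real d + real n + real m + real k + \<Lambda> + 1 / \<epsilon>"
  define W where "W = 1 + d + n + K"
  have B: "1 \<le> B" "real d + real n + 1 \<le> B" "real m \<le> B" "real k \<le> B" "\<Lambda> \<le> B" "1 / \<epsilon> \<le> B"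
    using pos by (auto simp: B_def)
  have W1: "1 \<le> W" by (simp add: W_def)
  have W: "d \<le> W" "n \<le> W" "K \<le> W" by (auto simp: W_def)
  have W12: "W \<le> W ^ 2" "W ^ 2 \<le> W ^ 3" "W ^ 3 \<le> W ^ 4" "1 \<le> W ^ 3"
    using W1 by (auto intro: power_increasing self_le_power)
  have "n * (n * (3 * d + 7) + 3 * d + 11) \<le> W * (W * (3 * W + 7) + 3 * W + 11)"
    using W by (intro mult_le_mono add_le_mono) auto
  also have "\<dots> = 3 * W ^ 3 + 10 * W ^ 2 + 11 * W"
    by (simp add: power2_eq_square power3_eq_cube algebra_simps)
  finally have 1: "n * (n * (3 * d + 7) + 3 * d + 11) \<le> 24 * W ^ 3" using W12 by linarith
  have "n * (15 * d + 3 * K + 23) \<le> W * (15 * W + 3 * W + 23)"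
    using W by (intro mult_le_mono add_le_mono) auto
  also have "\<dots> = 18 * W ^ 2 + 23 * W" by (simp add: power2_eq_square algebra_simps)
  finally have 2: "n * (15 * d + 3 * K + 23) \<le> 41 * W ^ 3" using W12 by linarith
  have "n * (3 * d + 6) \<le> W * (3 * W + 6)" using W by (intro mult_le_mono add_le_mono) auto
  also have "\<dots> = 3 * W ^ 2 + 6 * W" by (simp add: power2_eq_square algebra_simps)
  finally have 3: "n * (3 * d + 6) \<le> 9 * W ^ 4" using W12 by linarith
  have "n * (n * (3 * d + 7) + 3 * d + 11) + n * (15 * d + 3 * K + 23) + 6 * d + 13 \<le> 84 * W ^ 3"
    using 1 2 W12 W by linarith
  then have "K * (n * (n * (3 * d + 7) + 3 * d + 11) + n * (15 * d + 3 * K + 23) + 6 * d + 13)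
      \<le> W * (84 * W ^ 3)" using W by (intro mult_le_mono) auto
  also have "\<dots> = 84 * W ^ 4" by (simp add: power3_eq_cube power4_eq_xxxx)
  finally have "K * (n * (n * (3 * d + 7) + 3 * d + 11) + n * (15 * d + 3 * K + 23) + 6 * d + 13)
      + n * (3 * d + 6) + 5 \<le> 100 * W ^ 4" using 3 W12 by linarith
  then have "real (K * (n * (n * (3 * d + 7) + 3 * d + 11) + n * (15 * d + 3 * K + 23) + 6 * d + 13)
      + n * (3 * d + 6) + 5) \<le> real (100 * W ^ 4)" by (rule of_nat_mono)
  also have "real (100 * W ^ 4) = 100 * real W ^ 4" by simp
  also have "\<dots> \<le> 100 * (1027 * B ^ 11) ^ 4"
  proof -
    have "real m * real k ^ 2 * \<Lambda> ^ 3 * (1 / \<epsilon>) ^ 5 \<le> B * B ^ 2 * B ^ 3 * B ^ 5"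
      using B pos by (intro mult_mono power_mono) auto
    also have "\<dots> = B ^ 11" by (simp add: power_add[symmetric] flip: power_Suc)
    finally have "real m * real k ^ 2 * \<Lambda> ^ 3 / \<epsilon> ^ 5 \<le> B ^ 11" by (simp add: power_divide)
    moreover have "0 \<le> real m * real k ^ 2 * \<Lambda> ^ 3 / \<epsilon> ^ 5" using pos by simp
    ultimately have "real K \<le> 1024 * B ^ 11 + 1" unfolding K by linarith
    moreover have "B \<le> B ^ 11" using B by (simp add: self_le_power)
    ultimately have "real W \<le> 1027 * B ^ 11" using B unfolding W_def by simp
    then have "real W ^ 4 \<le> (1027 * B ^ 11) ^ 4" by (rule power_mono) simp
    then show ?thesis by simp
  qed
  also have "\<dots> = 100 * 1027 ^ 4 * B ^ 44" by (simp add: power_mult_distrib flip: power_mult)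
  finally show ?thesis by (simp add: B_def)
qed

theorem corollary5:
  shows "\<exists>(C\<^sub>1::real) (C\<^sub>2::real) (P::com) (c::real) (q::nat).
    \<forall>(d::nat) (n::nat) (m::nat) (k::nat) (X::real mat) (\<Lambda>::real) (\<gamma>::real) (\<epsilon>::real)
      (As::real mat) (Ys::real mat).
      X \<in> carrier_mat d n \<longrightarrow> m > 0 \<longrightarrow> k > 0 \<longrightarrow> \<Lambda> > 0 \<longrightarrow> \<gamma> \<ge> 0 \<longrightarrow> \<epsilon> > 0 \<longrightarrow>
      As \<in> carrier_mat d m \<longrightarrow> Ys \<in> carrier_mat m n \<longrightarrow>
      (\<forall>j<m. enorm (col As j) = 1) \<longrightarrow>
      (\<forall>i<n. sparse k (col Ys i) \<and> (enorm (col Ys i))\<^sup>2 \<le> \<Lambda> * (enorm (col X i))\<^sup>2) \<longrightarrow>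
      (fnorm (X - As * Ys))\<^sup>2 \<le> \<gamma> * (fnorm X)\<^sup>2 \<longrightarrow>
      (\<exists>t A' Y'. outputs P X m k \<Lambda> \<epsilon> t A' Y' \<and>
        real t \<le> c * (1 + real d + real n + real m + real k + \<Lambda> + 1 / \<epsilon>) ^ q \<and>
        (fnorm (X - A' * Y'))\<^sup>2 \<le> (\<gamma> + \<epsilon>) * (fnorm X)\<^sup>2 \<and>
        int (dim_col A') \<le> \<lceil>C\<^sub>1 * (real m * real k ^ 2 * \<Lambda> ^ 3 / \<epsilon> ^ 5)\<rceil> \<and>
        (\<forall>i<n. real (nnz (col Y' i)) \<le> C\<^sub>2 * (real k ^ 2 * \<Lambda> ^ 2 / \<epsilon> ^ 4)))"
proof -
  have main: "\<exists>t A' Y'. outputs pursuit X m k \<Lambda> \<epsilon> t A' Y' \<and>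
      real t \<le> (100 * 1027 ^ 4) * (1 + real d + real n + real m + real k + \<Lambda> + 1 / \<epsilon>) ^ 44 \<and>
      (fnorm (X - A' * Y'))\<^sup>2 \<le> (\<gamma> + \<epsilon>) * (fnorm X)\<^sup>2 \<and>
      int (dim_col A') \<le> \<lceil>1024 * (real m * real k ^ 2 * \<Lambda> ^ 3 / \<epsilon> ^ 5)\<rceil> \<and>
      (\<forall>i<n. real (nnz (col Y' i)) \<le> 1024 * (real k ^ 2 * \<Lambda> ^ 2 / \<epsilon> ^ 4))"
    if H: "X \<in> carrier_mat d n" "m > 0" "k > 0" "\<Lambda> > 0" "\<epsilon> > 0"
      "As \<in> carrier_mat d m" "Ys \<in> carrier_mat m n" "\<forall>j<m. enorm (col As j) = 1"
      "\<forall>i<n. sparse k (col Ys i) \<and> (enorm (col Ys i))\<^sup>2 \<le> \<Lambda> * (enorm (col X i))\<^sup>2"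
      "(fnorm (X - As * Ys))\<^sup>2 \<le> \<gamma> * (fnorm X)\<^sup>2"
    for d n m k :: nat and X As Ys :: "real mat" and \<Lambda> \<gamma> \<epsilon> :: real
  proof -
    define c where "c = \<epsilon> ^ 4 / (1024 * real k ^ 2 * \<Lambda> ^ 2)"
    define \<tau> where "\<tau> = 1024 * (real m * real k ^ 2 * \<Lambda> ^ 3 / \<epsilon> ^ 5)"
    define K where "K = nat \<lceil>\<tau>\<rceil>"
    obtain t s where exec: "exec pursuit (input_store X m k \<Lambda> \<epsilon>) t s"
      and t: "t \<le> K * (n * (n * (3 * d + 7) + 3 * d + 11) + n * (15 * d + 3 * K + 23) + 6 * d + 13)
        + n * (3 * d + 6) + 5"
      and state: "pursuit_state d n c \<tau> (entries X) K s"
      and error: "sq_error d n s \<le> (\<gamma> + \<epsilon>) * (fnorm X)\<^sup>2"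
      using tot_pursuit[OF H c_def \<tau>_def K_def] unfolding tot_def by (elim exE conjE)
    have M: "reg s ''m_out'' = K" and S: "arr s ''X'' = entries X"
      and col: "\<And>i. i < n \<Longrightarrow> column_inv d c (arr s ''A'') K
        (\<lambda>a. entries X a i) (\<lambda>a. arr s ''P'' a i) (\<lambda>h. arr s ''Y'' h i)"
      using state by (auto simp: pursuit_state_def)
    define A where "A = array_mat s ''A'' d K"
    define Y where "Y = array_mat s ''Y'' K n"
    have A: "A \<in> carrier_mat d K" and Y: "Y \<in> carrier_mat K n"
      by (auto simp: A_def Y_def array_mat_def)
    have "outputs pursuit X m k \<Lambda> \<epsilon> t A Y"
      unfolding outputs_def using exec H(1) M by (auto simp: A_def Y_def)
    moreover have "real t \<le> (100 * 1027 ^ 4) * (1 + real d + real n + real m + real k + \<Lambda> + 1 / \<epsilon>) ^ 44"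
      using pursuit_time_bound[OF H(4,5) K_def[unfolded \<tau>_def], of n d] t by linarith
    moreover have "(fnorm (X - A * Y))\<^sup>2 = sq_error d n s"
    proof -
      \<comment> \<open>By the invariant \<open>P\<close> is the product of the output matrices, so
        the error that the program tracks is the true one.\<close>
      have "X $$ (b, i) - (\<Sum>h<K. Y $$ (h, i) * A $$ (b, h)) = res s i b" if "i < n" "b < d" for i b
        using col[OF that(1)] that H(1)
        by (simp add: S entries_def column_inv_def A_def Y_def array_mat_def)
      then show ?thesis
        unfolding fnorm_diff_mult_sq[OF H(1) A Y] by (simp add: dot_def power2_eq_square)
    qed
    moreover have "int (dim_col A) \<le> \<lceil>\<tau>\<rceil>"
    proof -
      \<comment> \<open>Needed to pass from \<open>nat\<close> of the ceiling back to the integer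
        ceiling.\<close>
      have "0 \<le> \<tau>" using H by (simp add: \<tau>_def)
      then show ?thesis using A by (simp add: K_def)
    qed
    \<comment> \<open>The bound is \<open>1 / c\<close>, so the constant is the 1024 from the
      definition of \<open>c\<close>.\<close>
    moreover have "real (nnz (col Y i)) \<le> 1024 * (real k ^ 2 * \<Lambda> ^ 2 / \<epsilon> ^ 4)" if i: "i < n" for i
    proof -
      have "{h. h < K \<and> Y $$ (h, i) \<noteq> 0} = {h. h < K \<and> arr s ''Y'' h i \<noteq> 0}"
        using i by (auto simp: Y_def array_mat_def)
      then have "real (nnz (col Y i)) \<le> 1 / c"
        using column_inv_card[OF col[OF i]] H nnz_col[OF Y i] by (simp add: c_def)
      then show ?thesis by (simp add: c_def)
    qed
    ultimately show ?thesis
      using error unfolding \<tau>_def by (intro exI[of _ t] exI[of _ A] exI[of _ Y]) simp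
  qed
  show ?thesis
    by (rule exI[of _ 1024], rule exI[of _ 1024], rule exI[of _ pursuit],
        rule exI[of _ "100 * 1027 ^ 4"], rule exI[of _ 44], intro allI impI, rule main)
qed

end
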